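(* If $n\geq 3$, then the Bergman kernel $\mathbb{B}_{\Omega_{n,n-1}}$ of the domain $$\Omega_{n,n-1}=\{z\in\mathbb{D}^n \mid |z_1 z_2\cdots z_{n-1}|<|z_n|\}\subset\mathbb{C}^n$$ is not a rational function of the coordinates (i.e. $\mathbb{B}_{\Omega_{n,n-1}}(z,w)$ is not a rational function of $z_1,\dots,z_n,\overline{w_1},\dots,\overline{w_n}$).
   Context: $\mathbb{D}^n=\{z\in\mathbb{C}^n \mid |z_j|<1 \text{ for } 1\leq j\leq n\}$ is the unit polydisc. For a domain $\Omega\subset\mathbb{C}^n$, the Bergman space $A^2(\Omega)$ is the Hilbert space of holomorphic functions on $\Omega$ that are square integrable with respect to Lebesgue measure $dV$, and the Bergman kernel $\mathbb{B}_\Omega:\Omega\times\Omega\to\mathbb{C}$ is its reproducing kernel: it is holomorphic in the first and anti-holomorphic in the second variable, and $f(z)=\int_\Omega f(w)\,\mathbb{B}_\Omega(z,w)\,dV(w)$ for all $f\in A^2(\Omega)$, $z\in\Omega$. *)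

theory Defs
  imports
    "HOL-Analysis.Analysis"
    "HOL-Library.Poly_Mapping"
begin

text \<open>
  Points of \<open>\<complex>\<^sup>n\<close> are vectors \<open>z :: complex ^ 'n\<close> with \<open>n = CARD('n)\<close>. The index type \<open>'n\<close> is
  unordered, so the coordinate that plays the role of \<open>z\<^sub>n\<close> is passed as an explicit index \<open>k\<close>,
  and \<open>z\<^sub>1, \<dots>, z\<^sub>n\<^sub>-\<^sub>1\<close> are the coordinates with index in \<open>- {k}\<close>.
\<close>

definition polydisc :: "(complex ^ 'n) set" where
  "polydisc = {z. \<forall>j. cmod (z $ j) < 1}"

definition hartogs_domain :: "'n \<Rightarrow> (complex ^ 'n) set" where
  "hartogs_domain k = {z \<in> polydisc. cmod (\<Prod>j \<in> - {k}. z $ j) < cmod (z $ k)}"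

text \<open>Complex differentiability: the real Frechet derivative exists and is complex linear.\<close>

definition mholomorphic_on :: "(complex ^ 'n \<Rightarrow> complex) \<Rightarrow> (complex ^ 'n) set \<Rightarrow> bool"
    (infixl \<open>mholomorphic'_on\<close> 50) where
  "f mholomorphic_on \<Omega> \<longleftrightarrow>
     (\<forall>z\<in>\<Omega>. \<exists>D. (f has_derivative D) (at z) \<and> (\<forall>c v. D (c *s v) = c * D v))"

text \<open>
  Elements of the Bergman space are total functions, of which only the values on \<open>\<Omega>\<close> matter.
\<close>

definition bergman_space :: "(complex ^ 'n) set \<Rightarrow> (complex ^ 'n \<Rightarrow> complex) set" where
  "bergman_space \<Omega> =
     {f. f mholomorphic_on \<Omega> \<and> set_integrable lborel \<Omega> (\<lambda>z. (cmod (f z))\<^sup>2)}"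

text \<open>
  As usual for reproducing kernels, \<open>\<lambda>w. cnj (K z w)\<close> is required to belong to the Bergman space
  (and not only to be holomorphic); this is what makes \<open>K\<close> unique on \<open>\<Omega> \<times> \<Omega>\<close>.
\<close>

definition is_bergman_kernel ::
    "(complex ^ 'n) set \<Rightarrow> (complex ^ 'n \<Rightarrow> complex ^ 'n \<Rightarrow> complex) \<Rightarrow> bool" where
  "is_bergman_kernel \<Omega> K \<longleftrightarrow>
     (\<forall>w\<in>\<Omega>. (\<lambda>z. K z w) mholomorphic_on \<Omega>) \<and>
     (\<forall>z\<in>\<Omega>. (\<lambda>w. cnj (K z w)) \<in> bergman_space \<Omega>) \<and>
     (\<forall>f\<in>bergman_space \<Omega>. \<forall>z\<in>\<Omega>. f z = (LINT w:\<Omega>|lborel. f w * K z w))"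

lemma bergman_kernel_unique:
  assumes "is_bergman_kernel \<Omega> K" "is_bergman_kernel \<Omega> L" "z \<in> \<Omega>" "w \<in> \<Omega>"
  shows "K z w = L z w"
proof -
  have K: "(\<lambda>v. cnj (K a v)) \<in> bergman_space \<Omega>" and L: "(\<lambda>v. cnj (L a v)) \<in> bergman_space \<Omega>"
    if "a \<in> \<Omega>" for a
    using assms that by (auto simp: is_bergman_kernel_def)
  have "cnj (K a b) = L b a" if "a \<in> \<Omega>" "b \<in> \<Omega>"
    and "is_bergman_kernel \<Omega> K" "is_bergman_kernel \<Omega> L" for a b K L
  proof -
    have "cnj (K a b) = (LINT v:\<Omega>|lborel. cnj (K a v) * L b v)"
      using that by (auto simp: is_bergman_kernel_def)
    also have "\<dots> = cnj (LINT v:\<Omega>|lborel. cnj (L b v) * K a v)"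
      unfolding set_lebesgue_integral_def
      by (subst Bochner_Integration.integral_cnj [symmetric])
         (auto intro!: Bochner_Integration.integral_cong simp: mult_ac scaleR_conv_of_real)
    also have "(LINT v:\<Omega>|lborel. cnj (L b v) * K a v) = cnj (L b a)"
      using that by (auto simp: is_bergman_kernel_def)
    finally show ?thesis by simp
  qed
  from this[of z w K L] this[of z w L L] assms
  show ?thesis by (metis complex_cnj_cancel_iff)
qed

text \<open>
  Polynomials over \<open>'a\<close> in finitely many variables indexed by \<open>'i\<close> are finitely supported
  families of coefficients, indexed by exponent vectors.
\<close>

type_synonym ('i, 'a) mpolynomial = "('i \<Rightarrow>\<^sub>0 nat) \<Rightarrow>\<^sub>0 'a"

definition mpoly_eval :: "('i::finite, 'a::comm_semiring_1) mpolynomial \<Rightarrow> ('i \<Rightarrow> 'a) \<Rightarrow> 'a" where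
  "mpoly_eval p x =
     (\<Sum>m\<in>Poly_Mapping.keys p.
        Poly_Mapping.lookup p m * (\<Prod>i\<in>UNIV. x i ^ Poly_Mapping.lookup m i))"

text \<open>
  Variable \<open>Inl j\<close> stands for \<open>z\<^sub>j\<close> and variable \<open>Inr j\<close> for the conjugate of \<open>w\<^sub>j\<close>.
  The denominator may vanish at points of \<open>\<Omega> \<times> \<Omega>\<close>; it only has to be a nonzero polynomial.
\<close>

definition rational_kernel_on ::
    "(complex ^ 'n) set \<Rightarrow> (complex ^ 'n \<Rightarrow> complex ^ 'n \<Rightarrow> complex) \<Rightarrow> bool" where
  "rational_kernel_on \<Omega> K \<longleftrightarrow>
     (\<exists>(P :: ('n + 'n, complex) mpolynomial) Q. Q \<noteq> 0 \<and>
        (\<forall>z\<in>\<Omega>. \<forall>w\<in>\<Omega>.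
           let x = case_sum (\<lambda>j. z $ j) (\<lambda>j. cnj (w $ j))
           in mpoly_eval Q x \<noteq> 0 \<longrightarrow> K z w = mpoly_eval P x / mpoly_eval Q x))"

end

theory Submission
  imports
    Defs
    "HOL-Complex_Analysis.Complex_Residues"
    "HOL-Computational_Algebra.Fundamental_Theorem_Algebra"
begin

text \<open>
  Write \<open>\<Omega>\<close> for the domain, \<open>m = n - 1 \<ge> 2\<close> for the number of coordinates other than \<open>z\<^sub>k\<close>, and
  suppose that \<open>K(z, w) = P(z, w*) / Q(z, w*)\<close> with polynomials \<open>P\<close> and \<open>Q \<noteq> 0\<close>, where \<open>w*\<close> is the
  conjugate of \<open>w\<close>. One point \<open>z\<close> suffices for a contradiction: choose \<open>z \<in> \<Omega>\<close> such that \<open>Q(z, \<cdot>)\<close> is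
  not the zero polynomial. Then \<open>f(w) = cnj K(z, w)\<close> is an element of the Bergman space that satisfies
  \<open>q f = r\<close> on \<open>\<Omega>\<close> with polynomials \<open>q \<noteq> 0\<close> and \<open>r\<close> in \<open>w\<close>.

  The domain is invariant under rotations of each coordinate, so that multiplying \<open>q f = r\<close> by
  \<open>cnj (w\<^sup>\<gamma>)\<close> and integrating over \<open>\<Omega>\<close> compares Laurent coefficients. Let \<open>b\<^sub>\<beta>\<close> be the coefficients
  of \<open>q\<close>, let \<open>\<beta>\<^sup>0\<close> with \<open>b\<^sub>\<beta>\<^sub>0 \<noteq> 0\<close> have the least total degree in the coordinates other than \<open>k\<close>, and
  let \<open>\<gamma>\<close> agree with \<open>\<beta>\<^sup>0\<close> off \<open>k\<close> and have a large \<open>k\<close>-th entry \<open>t\<close>.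

  \<^item> The right-hand side contributes nothing, by orthogonality of monomials
    (\<open>integral_monoms_orthogonal\<close>).

  \<^item> In each coordinate other than \<open>k\<close> the slices of \<open>\<Omega>\<close> are discs about \<open>0\<close>, so that a term
    \<open>b\<^sub>\<beta> w\<^sup>\<beta> f\<close> with \<open>\<beta>\<^sub>j > \<gamma>\<^sub>j\<close> for some \<open>j \<noteq> k\<close> contributes nothing
    (\<open>integral_bergman_times_monoms_eq_0\<close>). By the choice of \<open>\<beta>\<^sup>0\<close>, only the terms remain in which
    \<open>\<beta>\<close> agrees with \<open>\<beta>\<^sup>0\<close> off \<open>k\<close>.

  \<^item> The term with \<open>\<beta>\<^sub>k = i\<close> contributes \<open>b\<^sub>\<beta> C(t - i) \<parallel>w\<^sup>\<gamma>\<parallel>\<^sup>2\<close>, where \<open>C(d)\<close> is the Laurent coefficient of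
    index \<open>d\<close> of \<open>a \<mapsto> f(0, \<dots>, 0, a)\<close> (\<open>integral_bergman_times_monoms\<close>). The reproducing property,
    applied to \<open>w\<^sub>k\<^sup>d\<close>, gives \<open>C(d) = cnj (z\<^sub>k)\<^sup>d / \<parallel>w\<^sub>k\<^sup>d\<parallel>\<^sup>2\<close>.

  An elementary integration yields \<open>\<parallel>w\<^sub>k\<^sup>d\<parallel>\<^sup>2 = \<pi>\<^sup>n \<Psi>(x) / x\<^sup>m\<close> with \<open>x = d + 2\<close> and
  \<open>\<Psi>(x) = 1 + x + \<dots> + x\<^sup>m\<^sup>-\<^sup>1\<close> (\<open>integral_coordinate_power\<close>). Hence finitely many shifts of the rational
  function \<open>x\<^sup>m / \<Psi>(x)\<close> are linearly dependent. This is impossible (\<open>no_shift_relation\<close>): as \<open>m \<ge> 2\<close>, \<open>\<Psi>\<close>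
  has a root, and the shift by the largest \<open>i\<close> of a root with the largest real part is a pole
  of exactly one of the functions. For \<open>m = 1\<close> there is no pole, and the kernel is indeed rational.
\<close>

(* The symbol $ is to denote the components of vectors only. *)
no_notation fps_nth (infixl \<open>$\<close> 75)

section \<open>Lebesgue measure on complex vectors\<close>

text \<open>
  The proof is the uniqueness argument for Haar measures: by translation invariance and Fubini, the
  image measure \<open>\<mu>\<close> satisfies \<open>\<mu>(A) \<lambda>(B) = \<lambda>(A) \<lambda>(B)\<close> for the unit ball \<open>B\<close>, which an isometry preserves.
\<close>

lemma lborel_distr_linear_isometry:
  fixes T :: "'a::euclidean_space \<Rightarrow> 'a"
  assumes lin: "linear T" and iso: "\<And>x. norm (T x) = norm x"
  shows "distr lborel borel T = lborel"
proof (rule measure_eqI)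
  fix A assume "A \<in> sets (distr lborel borel T)"
  then have A[measurable]: "A \<in> sets borel" by simp
  define B :: "'a set" where "B = ball 0 1"
  have B[measurable]: "B \<in> sets borel" by (simp add: B_def)
  have T[measurable]: "T \<in> borel_measurable borel"
    using lin by (intro borel_measurable_continuous_onI linear_continuous_on) (simp add: linear_conv_bounded_linear[symmetric])
  have "inj T"
    unfolding linear_injective_0[OF lin] using iso by (metis norm_eq_zero)
  then have "surj T"
    using lin linear_injective_imp_surjective by blast
  then obtain S where S: "\<And>y. T (S y) = y" by (metis surjD)
  have shift: "(\<integral>\<^sup>+x. g (x + a) \<partial>lborel) = (\<integral>\<^sup>+x. g x \<partial>lborel)"
    if "g \<in> borel_measurable borel" for g :: "'a \<Rightarrow> ennreal" and a
    using that nn_integral_distr[of "(+) a" lborel borel g] lborel_distr_plus[of a]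
    by (simp add: add.commute)
  have "emeasure (distr lborel borel T) A * emeasure lborel B
      = (\<integral>\<^sup>+x. indicator A (T x) \<partial>lborel) * (\<integral>\<^sup>+y. indicator B y \<partial>lborel)"
    using nn_integral_distr[of T lborel borel "indicator A"] by simp
  also have "\<dots> = (\<integral>\<^sup>+y. (\<integral>\<^sup>+x. indicator A (T x) \<partial>lborel) * indicator B y \<partial>lborel)"
    by (simp add: nn_integral_cmult)
  also have "\<dots> = (\<integral>\<^sup>+y. (\<integral>\<^sup>+x. indicator A (T x + y) * indicator B y \<partial>lborel) \<partial>lborel)"
  proof (rule nn_integral_cong)
    fix y
    have "(\<integral>\<^sup>+x. indicator A (T x + y) \<partial>lborel) = (\<integral>\<^sup>+x. indicator A (T (x + S y)) \<partial>lborel)"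
      by (simp add: linear_add[OF lin] S)
    also have "\<dots> = (\<integral>\<^sup>+x. indicator A (T x) \<partial>lborel)"
      by (rule shift[of "\<lambda>x. indicator A (T x)"]) measurable
    finally show "(\<integral>\<^sup>+x. indicator A (T x) \<partial>lborel) * indicator B y
        = (\<integral>\<^sup>+x. indicator A (T x + y) * indicator B y \<partial>lborel)"
      by (simp add: nn_integral_multc)
  qed
  also have "\<dots> = (\<integral>\<^sup>+x. (\<integral>\<^sup>+y. indicator A (T x + y) * indicator B y \<partial>lborel) \<partial>lborel)"
    by (rule lborel_pair.Fubini') measurable
  also have "\<dots> = (\<integral>\<^sup>+x. (\<integral>\<^sup>+y. indicator A y * indicator B (y - T x) \<partial>lborel) \<partial>lborel)"
  proof (rule nn_integral_cong)
    fix x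
    show "(\<integral>\<^sup>+y. indicator A (T x + y) * indicator B y \<partial>lborel)
        = (\<integral>\<^sup>+y. indicator A y * indicator B (y - T x) \<partial>lborel)"
      using shift[of "\<lambda>y. indicator A y * indicator B (y - T x)" "T x"]
      by (simp add: add.commute)
  qed
  also have "\<dots> = (\<integral>\<^sup>+y. (\<integral>\<^sup>+x. indicator A y * indicator B (y - T x) \<partial>lborel) \<partial>lborel)"
    by (rule lborel_pair.Fubini') measurable
  also have "\<dots> = (\<integral>\<^sup>+y. indicator A y * emeasure lborel B \<partial>lborel)"
  proof (rule nn_integral_cong)
    fix y
    have "(\<integral>\<^sup>+x. indicator B (y - T x) \<partial>lborel) = (\<integral>\<^sup>+x. indicator (ball (S y) 1) x \<partial>lborel)"
    proof (rule nn_integral_cong)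
      fix x
      have "y - T x = T (S y - x)" by (simp add: linear_diff[OF lin] S)
      then have "norm (y - T x) = norm (S y - x)" by (simp add: iso)
      then show "indicator B (y - T x) = (indicator (ball (S y) 1) x :: ennreal)"
        by (simp add: B_def indicator_def dist_norm norm_minus_commute)
    qed
    also have "\<dots> = emeasure lborel B"
      by (simp add: B_def emeasure_ball)
    finally show "(\<integral>\<^sup>+x. indicator A y * indicator B (y - T x) \<partial>lborel)
        = indicator A y * emeasure lborel B"
      by (simp add: nn_integral_cmult)
  qed
  also have "\<dots> = emeasure lborel A * emeasure lborel B"
    by (simp add: nn_integral_multc)
  finally have eq: "emeasure (distr lborel borel T) A * emeasure lborel B
      = emeasure lborel A * emeasure lborel B" .
  have "emeasure lborel B \<noteq> 0" "emeasure lborel B \<noteq> top"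
    by (auto simp: B_def emeasure_ball less_imp_neq[OF unit_ball_vol_pos, symmetric])
  then show "emeasure (distr lborel borel T) A = emeasure lborel A"
    using eq by (metis ennreal_mult_cancel_left mult.commute)
qed simp

lemma vec_lambda_measurable:
  "(\<lambda>x. \<chi> i. x i) \<in> measurable (Pi\<^sub>M (UNIV::'n::finite set) (\<lambda>_. lborel :: 'a::euclidean_space measure)) borel"
proof (rule borel_measurable_euclidean_space[THEN iffD2], rule ballI)
  fix b :: "'a ^ 'n" assume "b \<in> Basis"
  then obtain i u where b: "b = axis i u" "u \<in> Basis" by (auto simp: Basis_vec_def)
  show "(\<lambda>x. (\<chi> i. x i) \<bullet> b) \<in> borel_measurable (Pi\<^sub>M UNIV (\<lambda>_. lborel))"
    unfolding b inner_axis by simp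
qed

text \<open>
  Lebesgue measure on vectors is the product of the Lebesgue measures of the components. This gives
  access to Fubini's theorem one coordinate at a time.
\<close>

lemma lborel_vec_eq:
  "(lborel :: ('a::euclidean_space ^ 'n::finite) measure)
     = distr (Pi\<^sub>M UNIV (\<lambda>_. lborel)) borel (\<lambda>x. \<chi> i. x i)"
proof (rule lborel_eqI)
  interpret product_sigma_finite "\<lambda>_::'n. lborel :: 'a measure" ..
  fix l u :: "'a ^ 'n" assume le: "\<And>b. b \<in> Basis \<Longrightarrow> l \<bullet> b \<le> u \<bullet> b"
  have le': "l $ i \<bullet> b \<le> u $ i \<bullet> b" if "b \<in> Basis" for i b
    using le[of "axis i b"] that by (simp add: inner_axis axis_in_Basis_iff)
  have vim: "(\<lambda>x. \<chi> i. x i) -` box l u \<inter> space (Pi\<^sub>M UNIV (\<lambda>_. lborel)) = Pi\<^sub>E UNIV (\<lambda>i. box (l $ i) (u $ i))"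
    by (auto simp: box_def space_PiM Basis_vec_def inner_axis PiE_def Pi_def)
  have "emeasure (distr (Pi\<^sub>M UNIV (\<lambda>_. lborel)) borel (\<lambda>x. \<chi> i. x i)) (box l u)
      = emeasure (Pi\<^sub>M UNIV (\<lambda>_. lborel)) (Pi\<^sub>E UNIV (\<lambda>i. box (l $ i) (u $ i)))"
    by (subst emeasure_distr) (auto simp: vec_lambda_measurable vim)
  also have "\<dots> = (\<Prod>i\<in>UNIV. emeasure lborel (box (l $ i) (u $ i)))"
    by (rule emeasure_PiM) auto
  also have "\<dots> = (\<Prod>i\<in>UNIV. ennreal (\<Prod>b\<in>Basis. (u $ i - l $ i) \<bullet> b))"
    by (intro prod.cong refl emeasure_lborel_box) (use le' in auto)
  also have "\<dots> = ennreal (\<Prod>i\<in>UNIV. \<Prod>b\<in>Basis. (u $ i - l $ i) \<bullet> b)"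
    by (intro prod_ennreal prod_nonneg) (use le' in \<open>auto simp: inner_diff_left\<close>)
  also have "(\<Prod>i\<in>UNIV. \<Prod>b\<in>Basis. (u $ i - l $ i) \<bullet> b) = (\<Prod>b\<in>Basis. (u - l) \<bullet> b)"
  proof -
    have "(\<Prod>b\<in>Basis. (u - l) \<bullet> b) = (\<Prod>i\<in>UNIV. \<Prod>b\<in>(axis i) ` Basis. (u - l) \<bullet> b)"
      unfolding Basis_vec_def UNION_singleton_eq_range
      by (subst prod.UNION_disjoint) (auto simp: axis_eq_axis)
    also have "\<dots> = (\<Prod>i\<in>UNIV. \<Prod>b\<in>Basis. (u $ i - l $ i) \<bullet> b)"
      by (intro prod.cong refl, subst prod.reindex) (auto simp: inj_on_def axis_eq_axis inner_axis)
    finally show ?thesis ..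
  qed
  finally show "emeasure (distr (Pi\<^sub>M UNIV (\<lambda>_. lborel)) borel (\<lambda>x. \<chi> i. x i)) (box l u)
      = (\<Prod>b\<in>Basis. (u - l) \<bullet> b)" .
qed simp

section \<open>Norms of the powers of the distinguished coordinate\<close>

text \<open>
  For a uniformly distributed point \<open>w\<close> of the unit disc, \<open>|w|\<^sup>2\<close> is uniformly distributed on the unit
  interval. This takes the place of polar coordinates.
\<close>

lemma distr_cmod_square_disc:
  "distr (density lborel (indicator (ball (0::complex) 1))) borel (\<lambda>w. (cmod w)\<^sup>2)
     = density lborel (\<lambda>x. ennreal pi * indicator {0<..<1} x)" (is "?M = ?N")
proof (rule measure_eqI_lessThan)
  fix x :: real
  have M: "emeasure ?M {x<..} = emeasure lborel (ball (0::complex) 1 \<inter> {w. x < (cmod w)\<^sup>2})"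
  proof -
    have "emeasure ?M {x<..} = emeasure (density lborel (indicator (ball 0 1))) {w. x < (cmod w)\<^sup>2}"
      by (subst emeasure_distr) (auto simp: vimage_def)
    also have "\<dots> = (\<integral>\<^sup>+w. indicator (ball (0::complex) 1 \<inter> {w. x < (cmod w)\<^sup>2}) w \<partial>lborel)"
      by (subst emeasure_density)
         (auto intro!: borel_measurable_indicator nn_integral_cong simp: indicator_inter_arith simp del: nn_integral_indicator)
    also have "\<dots> = emeasure lborel (ball (0::complex) 1 \<inter> {w. x < (cmod w)\<^sup>2})"
      by (rule nn_integral_indicator) measurable
    finally show ?thesis .
  qed
  have disc: "emeasure lborel (cball (0::complex) r) = ennreal (pi * r\<^sup>2)" if "r \<ge> 0" for r
    using that by (simp add: emeasure_cball unit_ball_vol_2)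
  have N: "emeasure ?N {x<..} = ennreal pi * emeasure lborel ({0<..<1} \<inter> {x<..})"
    by (subst emeasure_density)
       (auto simp: nn_integral_cmult_indicator[symmetric] indicator_def intro!: nn_integral_cong)
  consider "x < 0" | "0 \<le> x" "x < 1" | "x \<ge> 1" by linarith
  then show "emeasure ?M {x<..} = emeasure ?N {x<..}"
  proof cases
    case 1
    then have "ball (0::complex) 1 \<inter> {w. x < (cmod w)\<^sup>2} = ball 0 1"
      by (auto intro: less_le_trans)
    moreover have "{0<..<1} \<inter> {x<..} = {0<..<1::real}" using 1 by auto
    ultimately show ?thesis by (simp add: M N emeasure_ball unit_ball_vol_2)
  next
    case 2
    have sq: "x < (cmod w)\<^sup>2 \<longleftrightarrow> sqrt x < cmod w" for w :: complex
      by (metis real_sqrt_less_iff real_sqrt_abs abs_norm_cancel)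
    have "sqrt x < 1" using 2 by simp
    then have "ball (0::complex) 1 \<inter> {w. x < (cmod w)\<^sup>2} = ball 0 1 - cball 0 (sqrt x)"
      by (auto simp: not_le sq)
    moreover have "cball (0::complex) (sqrt x) \<subseteq> ball 0 1"
      using \<open>sqrt x < 1\<close> by (simp add: cball_subset_ball_iff)
    then have "emeasure lborel (ball (0::complex) 1 - cball 0 (sqrt x))
        = ennreal pi - ennreal (pi * x)"
      using 2 by (subst emeasure_Diff) (auto simp: disc emeasure_ball unit_ball_vol_2)
    moreover have "{0<..<1} \<inter> {x<..} = {x<..<1::real}" using 2 by auto
    ultimately show ?thesis
      using 2 by (simp add: M N ennreal_mult[symmetric] ennreal_minus algebra_simps)
  next
    case 3
    have "(cmod w)\<^sup>2 < 1" if "cmod w < 1" for w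
      using that abs_square_less_1[of "cmod w"] by simp
    with 3 have "ball (0::complex) 1 \<inter> {w. x < (cmod w)\<^sup>2} = {}"
      by (smt (verit, best) disjoint_iff dist_0_norm mem_Collect_eq mem_ball)
    moreover have "{0<..<1} \<inter> {x<..} = ({}::real set)" using 3 by auto
    ultimately show ?thesis by (simp only: M N emeasure_empty mult_zero_right)
  qed
  show "emeasure ?M {x<..} < \<infinity>"
    unfolding M by (rule le_less_trans[OF emeasure_mono[of _ "ball 0 1"]]) (auto simp: emeasure_ball unit_ball_vol_2)
qed simp_all

lemma nn_integral_annulus_power:
  fixes p :: real
  assumes "0 \<le> p" "p \<le> 1"
  shows "(\<integral>\<^sup>+w. ennreal (cmod w ^ (2 * d)) * indicator {w. p < cmod w \<and> cmod w < 1} w \<partial>(lborel :: complex measure))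
     = ennreal (pi * (1 - p ^ (2 * d + 2)) / (d + 1))"
proof -
  have "(\<integral>\<^sup>+w. ennreal (cmod w ^ (2 * d)) * indicator {w. p < cmod w \<and> cmod w < 1} w \<partial>(lborel :: complex measure))
      = (\<integral>\<^sup>+w. ennreal (((cmod w)\<^sup>2) ^ d) * indicator {p\<^sup>2<..} ((cmod w)\<^sup>2)
            \<partial>density lborel (indicator (ball (0::complex) 1)))"
  proof (subst nn_integral_density)
    have sq: "p < cmod w \<longleftrightarrow> p\<^sup>2 < (cmod w)\<^sup>2" for w :: complex
      by (meson assms(1) norm_ge_zero power2_less_imp_less power_strict_mono zero_less_numeral)
    show "(\<integral>\<^sup>+w. ennreal (cmod w ^ (2 * d)) * indicator {w. p < cmod w \<and> cmod w < 1} w \<partial>(lborel :: complex measure))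
        = (\<integral>\<^sup>+w. indicator (ball 0 1) w * (ennreal (((cmod w)\<^sup>2) ^ d) * indicator {p\<^sup>2<..} ((cmod w)\<^sup>2)) \<partial>lborel)"
      by (intro nn_integral_cong) (simp add: power_mult indicator_def sq)
  qed (auto intro!: borel_measurable_indicator)
  also have "\<dots> = (\<integral>\<^sup>+x. ennreal (x ^ d) * indicator {p\<^sup>2<..} x
      \<partial>density lborel (\<lambda>x. ennreal pi * indicator {0<..<1} x))"
    by (subst distr_cmod_square_disc[symmetric], subst nn_integral_distr) auto
  also have "\<dots> = (\<integral>\<^sup>+x. ennreal (pi * x ^ d) * indicator {p\<^sup>2..1} x \<partial>lborel)"
  proof (subst nn_integral_density; (rule nn_integral_cong_AE)?)
    have "AE x in lborel. x \<noteq> p\<^sup>2 \<and> x \<noteq> (1::real)"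
      using AE_lborel_singleton[of "p\<^sup>2"] AE_lborel_singleton[of "1::real"] by eventually_elim simp
    then show "AE x in lborel. ennreal pi * indicator {0<..<1} x * (ennreal (x ^ d) * indicator {p\<^sup>2<..} x)
        = ennreal (pi * x ^ d) * indicator {p\<^sup>2..1} x"
    proof eventually_elim
      case (elim x)
      have "0 \<le> p\<^sup>2" by simp
      with elim have "0 < x" if "x > p\<^sup>2" using that by linarith
      with elim show ?case
        by (auto simp: indicator_def ennreal_mult)
    qed
  qed auto
  also have "\<dots> = ennreal (pi * 1 ^ (d + 1) / (d + 1) - pi * (p\<^sup>2) ^ (d + 1) / (d + 1))"
  proof (rule nn_integral_FTC_Icc[where F = "\<lambda>x. pi * x ^ (d + 1) / (d + 1)"])
    show "((\<lambda>x. pi * x ^ (d + 1) / (d + 1)) has_real_derivative pi * x ^ d) (at x)" for x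
      by (auto intro!: derivative_eq_intros simp del: power_Suc)
    show "0 \<le> pi * x ^ d" if "x \<in> {p\<^sup>2..1}" for x
      using order_trans[OF zero_le_power2, of p x] that by simp
  qed (use assms in \<open>auto simp: power_le_one\<close>)
  also have "pi * 1 ^ (d + 1) / (d + 1) - pi * (p\<^sup>2) ^ (d + 1) / (d + 1) = pi * (1 - p ^ (2 * d + 2)) / (d + 1)"
    using power_mult[of p 2 "d + 1"] by (simp add: diff_divide_distrib right_diff_distrib)
  finally show ?thesis .
qed

lemma open_polydisc: "open (polydisc :: (complex ^ 'n::finite) set)"
proof -
  have "polydisc = (\<Inter>j. {z :: complex ^ 'n. cmod (z $ j) < 1})"
    by (auto simp: polydisc_def)
  also have "open \<dots>"
    by (intro open_INT ballI open_Collect_less continuous_intros) simp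
  finally show ?thesis .
qed

lemma open_hartogs_domain: "open (hartogs_domain (k::'n::finite))"
proof -
  have "hartogs_domain k = polydisc \<inter> {z. cmod (\<Prod>j \<in> - {k}. z $ j) < cmod (z $ k)}"
    by (auto simp: hartogs_domain_def)
  also have "open \<dots>"
    by (intro open_Int open_polydisc open_Collect_less continuous_intros)
  finally show ?thesis .
qed

text \<open>
  For fixed values of the other coordinates, whose moduli have product \<open>p\<close>, the coordinate \<open>w\<^sub>k\<close>
  ranges over the annulus \<open>p < |w\<^sub>k| < 1\<close>. The integral over it is a multiple of \<open>1 - p\<^sup>2\<^sup>d\<^sup>+\<^sup>2\<close>, and both terms
  factor into integrals over the other coordinates.
\<close>

lemma nn_integral_hartogs_domain_power:
  "(\<integral>\<^sup>+w. ennreal (cmod (w $ k) ^ (2 * d)) * indicator (hartogs_domain (k::'n::finite)) w \<partial>lborel)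
     = ennreal (pi ^ CARD('n) / (d + 1) * (1 - 1 / (d + 2) ^ (CARD('n) - 1)))"
proof -
  interpret product_sigma_finite "\<lambda>_::'n. lborel :: complex measure" ..
  define D where "D = ball (0::complex) 1"
  define F where "F = (\<lambda>w. ennreal (cmod (w $ k) ^ (2 * d)) * indicator (hartogs_domain k) w)"
  define g where "g = (\<lambda>x. \<Prod>j\<in>-{k}. indicator D (x j) :: ennreal)"
  define h where "h = (\<lambda>x. \<Prod>j\<in>-{k}. ennreal (cmod (x j) ^ (2 * (d + 1))) * indicator D (x j))"
  define c where "c = ennreal (pi / (d + 1))"
  have D[measurable]: "D \<in> sets borel" by (simp add: D_def)
  have hart[measurable]: "hartogs_domain k \<in> sets borel"
    by (rule borel_open[OF open_hartogs_domain])
  have F[measurable]: "F \<in> borel_measurable borel"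
    unfolding F_def by (intro borel_measurable_times_ennreal borel_measurable_indicator hart
      measurable_compose[OF _ measurable_ennreal] borel_measurable_continuous_onI continuous_intros)
  note [measurable] = vec_lambda_measurable
  \<comment> \<open>the integral over the annulus, extended by \<open>0\<close> to all values of the other coordinates\<close>
  have inner: "(\<integral>\<^sup>+y. F (\<chi> i. (x(k := y)) i) \<partial>lborel) = c * (g x - h x)" for x
  proof (cases "\<forall>j\<in>-{k}. x j \<in> D")
    case True
    define p where "p = (\<Prod>j\<in>-{k}. cmod (x j))"
    have p: "0 \<le> p" "p \<le> 1"
      using True by (auto simp: p_def D_def less_imp_le intro!: prod_nonneg prod_le_1)
    have "F (\<chi> i. (x(k := y)) i)
        = ennreal (cmod y ^ (2 * d)) * indicator {w. p < cmod w \<and> cmod w < 1} y" for y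
    proof -
      have "(\<chi> i. (x(k := y)) i) \<in> hartogs_domain k \<longleftrightarrow> p < cmod y \<and> cmod y < 1"
        using True by (auto simp: hartogs_domain_def polydisc_def p_def D_def prod_norm[symmetric])
      then show ?thesis by (simp add: F_def indicator_def)
    qed
    then have "(\<integral>\<^sup>+y. F (\<chi> i. (x(k := y)) i) \<partial>lborel) = ennreal (pi * (1 - p ^ (2 * d + 2)) / (d + 1))"
      by (simp add: nn_integral_annulus_power[OF p])
    also have "pi * (1 - p ^ (2 * d + 2)) / (d + 1) = pi / (d + 1) * (1 - p ^ (2 * (d + 1)))"
      by simp
    also have "ennreal \<dots> = c * (1 - ennreal (p ^ (2 * (d + 1))))"
    proof -
      have "ennreal (pi / (d + 1) * (1 - r)) = c * (1 - ennreal r)" if "0 \<le> r" "r \<le> 1" for r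
        using that by (simp only: c_def ennreal_mult'' ennreal_minus flip: ennreal_1)
      then show ?thesis using p by (meson power_le_one zero_le_power)
    qed
    also have "ennreal (p ^ (2 * (d + 1))) = h x"
      using True unfolding h_def p_def prod_power_distrib by (simp add: prod_ennreal del: power_Suc)
    also have "1 = g x"
      using True by (simp add: g_def)
    finally show ?thesis .
  next
    case False
    then obtain j where "j \<in> - {k}" "x j \<notin> D" by blast
  then have "g x = 0" "h x = 0"
    unfolding g_def h_def by (auto intro!: prod_zero bexI[of _ j])
    moreover have "F (\<chi> i. (x(k := y)) i) = 0" for y
      using False by (auto simp: F_def hartogs_domain_def polydisc_def D_def indicator_def)
    ultimately show ?thesis by simp
  qed
  have ball: "integral\<^sup>N lborel (indicator D :: complex \<Rightarrow> ennreal) = ennreal pi"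
    by (simp add: D_def emeasure_ball unit_ball_vol_2)
  have pow: "(\<integral>\<^sup>+w. ennreal (cmod w ^ (2 * (d + 1))) * indicator D w \<partial>lborel) = ennreal (pi / (d + 2))"
  proof -
    have "(\<integral>\<^sup>+w. ennreal (cmod w ^ (2 * (d + 1))) * indicator D w \<partial>lborel)
        = (\<integral>\<^sup>+w. ennreal (cmod w ^ (2 * (d + 1))) * indicator {w. 0 < cmod w \<and> cmod w < 1} w
            \<partial>(lborel :: complex measure))"
      by (intro nn_integral_cong) (auto simp: D_def indicator_def)
    then show ?thesis using nn_integral_annulus_power[of 0 "d + 1"] by simp
  qed
  have cardC: "card (- {k}) = CARD('n) - 1" by (simp add: Compl_eq_Diff_UNIV)
  have g: "integral\<^sup>N (Pi\<^sub>M (-{k}) (\<lambda>_. lborel)) g = ennreal (pi ^ (CARD('n) - 1))"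
    unfolding g_def by (subst product_nn_integral_prod) (auto simp: ball cardC ennreal_power)
  have h: "integral\<^sup>N (Pi\<^sub>M (-{k}) (\<lambda>_. lborel)) h = ennreal ((pi / (d + 2)) ^ (CARD('n) - 1))"
  proof -
    have "integral\<^sup>N (Pi\<^sub>M (-{k}) (\<lambda>_. lborel)) h
        = (\<Prod>j\<in>-{k}. \<integral>\<^sup>+w. ennreal (cmod w ^ (2 * (d + 1))) * indicator D w \<partial>lborel)"
      unfolding h_def by (rule product_nn_integral_prod) auto
    also have "\<dots> = ennreal ((pi / (d + 2)) ^ (CARD('n) - 1))"
      unfolding pow by (simp add: cardC ennreal_power)
    finally show ?thesis .
  qed
  have "(\<integral>\<^sup>+w. F w \<partial>lborel) = (\<integral>\<^sup>+x. F (\<chi> i. x i) \<partial>(Pi\<^sub>M (insert k (-{k})) (\<lambda>_. lborel)))"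
    by (subst lborel_vec_eq, subst nn_integral_distr) (auto simp: insert_UNIV Compl_insert)
  also have "\<dots> = (\<integral>\<^sup>+x. (\<integral>\<^sup>+y. F (\<chi> i. (x(k := y)) i) \<partial>lborel) \<partial>(Pi\<^sub>M (-{k}) (\<lambda>_. lborel)))"
    by (rule product_nn_integral_insert) (auto simp: Compl_insert)
  also have "\<dots> = (\<integral>\<^sup>+x. c * (g x - h x) \<partial>(Pi\<^sub>M (-{k}) (\<lambda>_. lborel)))"
    by (intro nn_integral_cong inner)
  also have "\<dots> = c * (ennreal (pi ^ (CARD('n) - 1)) - ennreal ((pi / (d + 2)) ^ (CARD('n) - 1)))"
  proof -
    have gm[measurable]: "g \<in> borel_measurable (Pi\<^sub>M (-{k}) (\<lambda>_. lborel))" unfolding g_def by measurable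
    have hm[measurable]: "h \<in> borel_measurable (Pi\<^sub>M (-{k}) (\<lambda>_. lborel))" unfolding h_def by measurable
    have "ennreal (cmod w ^ (2 * (d + 1))) * indicator D w \<le> indicator D w" for w
      using power_le_one[of "cmod w" "2 * (d + 1)"] by (auto simp: D_def indicator_def)
    then have le: "h x \<le> g x" for x
      unfolding h_def g_def by (intro prod_mono_ennreal)
    have "(\<integral>\<^sup>+x. g x - h x \<partial>(Pi\<^sub>M (-{k}) (\<lambda>_. lborel)))
        = integral\<^sup>N (Pi\<^sub>M (-{k}) (\<lambda>_. lborel)) g - integral\<^sup>N (Pi\<^sub>M (-{k}) (\<lambda>_. lborel)) h"
      by (rule nn_integral_diff) (auto simp: h le)
    then show ?thesis by (subst nn_integral_cmult) (auto simp: g h)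
  qed
  also have "\<dots> = ennreal (pi / (d + 1) * (pi ^ (CARD('n) - 1) - (pi / (d + 2)) ^ (CARD('n) - 1)))"
    unfolding c_def by (subst ennreal_minus, simp, rule ennreal_mult'[symmetric], simp)
  also have "pi / (d + 1) * (pi ^ (CARD('n) - 1) - (pi / (d + 2)) ^ (CARD('n) - 1))
      = (pi * pi ^ (CARD('n) - 1)) / (d + 1) * (1 - 1 / (d + 2) ^ (CARD('n) - 1))"
    by (simp add: power_divide right_diff_distrib)
  also have "pi * pi ^ (CARD('n) - 1) = pi ^ CARD('n)"
    by (metis power_minus_mult zero_less_card_finite mult.commute)
  finally show ?thesis by (simp add: F_def add.commute)
qed

section \<open>Mean values over circles and coordinate rotations\<close>

text \<open>
  Circles are parametrised by \<open>t \<mapsto> cis (2 * pi * t) * r\<close> over the unit interval, so that integrals in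
  \<open>t\<close> are mean values.
\<close>

lemma has_contour_integral_circlepath_iff_mean:
  assumes "r > 0"
  shows "((\<lambda>u. f u / u) has_contour_integral (2 * of_real pi * \<i> * c)) (circlepath 0 r)
     \<longleftrightarrow> ((\<lambda>t. f (cis (2 * pi * t) * of_real r)) has_integral c) {0..1}"
proof -
  have "((\<lambda>u. f u / u) has_contour_integral (2 * of_real pi * \<i> * c)) (circlepath 0 r)
      \<longleftrightarrow> ((\<lambda>t. (2 * of_real pi * \<i>) * f (cis (2 * pi * t) * of_real r)) has_integral (2 * of_real pi * \<i>) * c) {0..1}"
    unfolding has_contour_integral_def
  proof (rule has_integral_cong)
    fix t :: real assume t: "t \<in> {0..1}"
    have "circlepath 0 r t = cis (2 * pi * t) * of_real r"
      by (simp add: circlepath cis_conv_exp mult_ac)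
    moreover have "vector_derivative (circlepath 0 r) (at t within {0..1})
        = 2 * of_real pi * \<i> * (cis (2 * pi * t) * of_real r)"
      using t by (simp add: vector_derivative_circlepath01 cis_conv_exp mult_ac)
    ultimately show "f (circlepath 0 r t) / circlepath 0 r t * vector_derivative (circlepath 0 r) (at t within {0..1})
        = (2 * of_real pi * \<i>) * f (cis (2 * pi * t) * of_real r)"
      using assms by simp
  qed
  also have "\<dots> \<longleftrightarrow> ((\<lambda>t. f (cis (2 * pi * t) * of_real r)) has_integral c) {0..1}"
  proof
    assume "((\<lambda>t. (2 * of_real pi * \<i>) * f (cis (2 * pi * t) * of_real r)) has_integral (2 * of_real pi * \<i>) * c) {0..1}"
    from has_integral_mult_right[OF this, of "1 / (2 * of_real pi * \<i>)"]
    show "((\<lambda>t. f (cis (2 * pi * t) * of_real r)) has_integral c) {0..1}" by simp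
  next
    assume "((\<lambda>t. f (cis (2 * pi * t) * of_real r)) has_integral c) {0..1}"
    from has_integral_mult_right[OF this]
    show "((\<lambda>t. (2 * of_real pi * \<i>) * f (cis (2 * pi * t) * of_real r)) has_integral (2 * of_real pi * \<i>) * c) {0..1}" .
  qed
  finally show ?thesis .
qed

lemma holomorphic_mean_value_circle:
  assumes "h holomorphic_on cball 0 (cmod a)"
  shows "((\<lambda>t. h (cis (2 * pi * t) * a)) has_integral h 0) {0..1}"
proof -
  have "(\<lambda>u. h (u * a)) holomorphic_on cball 0 1"
    by (rule holomorphic_on_compose_gen[OF _ assms, of "\<lambda>u. u * a", unfolded o_def])
       (auto simp: norm_mult mult_left_le_one_le intro!: holomorphic_intros)
  from Cauchy_integral_circlepath_simple[OF this, of 0]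
  have "((\<lambda>u. h (u * a) / u) has_contour_integral (2 * of_real pi * \<i> * h 0)) (circlepath 0 1)"
    by simp
  then show ?thesis
    using has_contour_integral_circlepath_iff_mean[of 1 "\<lambda>u. h (u * a)" "h 0"] by simp
qed

lemma has_integral_periodic_shift:
  fixes F :: "real \<Rightarrow> complex"
  assumes cont: "continuous_on UNIV F" and per: "\<And>t. F (t + 1) = F t"
  shows "((\<lambda>t. F (t + s)) has_integral integral {0..1} F) {0..1}"
proof -
  have int: "F integrable_on {a..b}" for a b
    using cont by (intro integrable_continuous_real) (auto intro: continuous_on_subset)
  have shift: "integral {a..b} (\<lambda>t. F (t + c)) = integral {a+c..b+c} F" for a b c
    using integral_shift_real_ivl[of "a + c" c "b + c" F] by simp
  have main: "integral {s..1 + s} F = integral {0..1} F" if "0 \<le> s" "s \<le> 1" for s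
  proof -
    have "integral {0..s} F + integral {s..1} F = integral {0..1} F"
      using that int by (intro Henstock_Kurzweil_Integration.integral_combine) auto
    moreover have "integral {s..1} F + integral {1..1+s} F = integral {s..1+s} F"
      using that int by (intro Henstock_Kurzweil_Integration.integral_combine) auto
    moreover have "integral {1..1+s} F = integral {0..s} F"
      using shift[of 0 s 1] per by (simp add: add.commute)
    ultimately show ?thesis by (metis add.commute)
  qed
  have per_nat: "F (t + of_nat n) = F t" for t n
    by (induction n) (auto simp: per add.assoc[symmetric] add.commute[of 1])
  have per_int: "F (t + of_int n) = F t" for t n
  proof (cases "n \<ge> 0")
    case True then show ?thesis using per_nat[of t "nat n"] by simp
  next
    case False then show ?thesis using per_nat[of "t + of_int n" "nat (- n)"] by simp
  qed
  have "F (t + s) = F (t + frac s)" for t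
    using per_int[of "t + frac s" "\<lfloor>s\<rfloor>"] by (simp add: frac_def)
  moreover have "integral {0..1} (\<lambda>t. F (t + frac s)) = integral {0..1} F"
    unfolding shift using main[of "frac s"] frac_lt_1[of s] by simp
  moreover have "(\<lambda>t. F (t + frac s)) integrable_on {0..1}"
    by (intro integrable_continuous_real continuous_on_compose2[OF cont] continuous_intros) auto
  ultimately show ?thesis by (metis (no_types, lifting) ext integrable_integral)
qed

text \<open>
  The constant \<open>C\<close> is the coefficient of index \<open>0\<close> of the Laurent expansion of \<open>h\<close>. By Cauchy's theorem the
  mean values over circles about \<open>0\<close> do not depend on the radius; the argument of \<open>a\<close> only shifts the
  parameter.
\<close>

lemma holomorphic_mean_value_punctured_disc:
  assumes h: "h holomorphic_on ball 0 1 - {0}"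
  obtains C where "\<And>a. a \<noteq> 0 \<Longrightarrow> cmod a < 1 \<Longrightarrow> ((\<lambda>t. h (cis (2 * pi * t) * a)) has_integral C) {0..1}"
proof -
  define I where "I = (\<lambda>r. integral {0..1} (\<lambda>t. h (cis (2 * pi * t) * of_real r)))"
  have hol: "(\<lambda>u. h u / u) holomorphic_on ball 0 1 - {0}"
    using h by (intro holomorphic_intros) auto
  have circ: "((\<lambda>u. h u / u) has_contour_integral (2 * of_real pi * \<i> * I r)) (circlepath 0 r)"
    if "(\<lambda>u. h u / u) contour_integrable_on circlepath 0 r" "r > 0" for r
  proof -
    define c where "c = contour_integral (circlepath 0 r) (\<lambda>u. h u / u) / (2 * of_real pi * \<i>)"
    have c: "((\<lambda>u. h u / u) has_contour_integral (2 * of_real pi * \<i> * c)) (circlepath 0 r)"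
      using has_contour_integral_integral[OF that(1)] by (simp add: c_def)
    then have "((\<lambda>t. h (cis (2 * pi * t) * of_real r)) has_integral c) {0..1}"
      using has_contour_integral_circlepath_iff_mean[OF that(2)] by blast
    then have "I r = c" unfolding I_def by (rule integral_unique)
    with c show ?thesis by simp
  qed
  have I_le: "I r = I s" if "0 < r" "r \<le> s" "s < 1" for r s
  proof -
    note eq = contour_integral_circlepath_eq[OF open_ball hol that(1,2)]
    have sub: "cball 0 s \<subseteq> ball (0::complex) 1" using that by (simp add: cball_subset_ball_iff)
    have "2 * of_real pi * \<i> * I r = 2 * of_real pi * \<i> * I s"
      using contour_integral_unique[OF circ[OF eq(1)[OF sub]]] contour_integral_unique[OF circ[OF eq(2)[OF sub]]]
        eq(3)[OF sub] that by simp
    then show ?thesis by simp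
  qed
  have I: "I r = I (1/2)" if "0 < r" "r < 1" for r
    using I_le[of r "1/2"] I_le[of "1/2" r] that by (cases "r \<le> 1/2") auto
  show ?thesis
  proof (rule that)
    fix a :: complex assume a: "a \<noteq> 0" "cmod a < 1"
    define F where "F = (\<lambda>t. h (cis (2 * pi * t) * of_real (cmod a)))"
    define s where "s = Arg a / (2 * pi)"
    have "cis (2 * pi * t) * a = cis (2 * pi * (t + s)) * of_real (cmod a)" for t
    proof -
      have "a = cis (2 * pi * s) * of_real (cmod a)"
        using a Arg_eq[of a] by (simp add: s_def cis_conv_exp mult_ac)
      then have "cis (2 * pi * t) * a = cis (2 * pi * t) * (cis (2 * pi * s) * of_real (cmod a))"
        by simp
      then show ?thesis by (simp add: cis_mult mult.assoc[symmetric] distrib_left)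
    qed
    then have "h (cis (2 * pi * t) * a) = F (t + s)" for t by (simp add: F_def)
    moreover have "((\<lambda>t. F (t + s)) has_integral integral {0..1} F) {0..1}"
    proof (rule has_integral_periodic_shift)
      show "continuous_on UNIV F" unfolding F_def
        using a by (intro continuous_on_compose2[OF holomorphic_on_imp_continuous_on[OF h]] continuous_intros)
          (auto simp: norm_mult)
      show "F (t + 1) = F t" for t
        by (simp add: F_def distrib_left cis_mult[symmetric])
    qed
    moreover have "integral {0..1} F = I (1/2)"
      using I[of "cmod a"] a by (simp add: F_def I_def)
    ultimately show "((\<lambda>t. h (cis (2 * pi * t) * a)) has_integral I (1/2)) {0..1}" by simp
  qed
qed

text \<open>
  Multiplication of the coordinate with index \<open>j\<close> by \<open>c\<close>; it is a rotation if \<open>c\<close> has modulus \<open>1\<close>.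
\<close>

definition rotate_coord :: "'n::finite \<Rightarrow> complex \<Rightarrow> complex ^ 'n \<Rightarrow> complex ^ 'n" where
  "rotate_coord j c w = (\<chi> i. if i = j then c * w $ i else w $ i)"

lemma rotate_coord_nth: "rotate_coord j c w $ i = (if i = j then c * w $ i else w $ i)"
  by (simp add: rotate_coord_def)

lemma lborel_distr_rotate_coord:
  assumes "cmod c = 1"
  shows "distr lborel borel (rotate_coord j c) = lborel"
proof (rule lborel_distr_linear_isometry)
  show "linear (rotate_coord j c)"
    by (rule linearI) (auto simp: vec_eq_iff rotate_coord_nth distrib_left)
  show "norm (rotate_coord j c w) = norm w" for w
    unfolding norm_vec_def using assms by (intro L2_set_cong) (auto simp: rotate_coord_nth norm_mult)
qed

text \<open>
  Here \<open>L w\<close> is the mean value of \<open>F\<close> over the rotations of the coordinate of \<open>w\<close> with index \<open>j\<close>. All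
  rotations of the integrand have the same integral over \<open>S\<close>, and Fubini's theorem exchanges the
  two integrations.
\<close>

lemma set_integral_rotation_average:
  fixes F :: "complex ^ 'n::finite \<Rightarrow> complex"
  assumes F: "set_integrable lborel S F"
    and inv: "\<And>w t. rotate_coord j (cis t) w \<in> S \<longleftrightarrow> w \<in> S"
    and cont: "\<And>w. w \<in> S \<Longrightarrow> continuous_on {0..1} (\<lambda>t. F (rotate_coord j (cis (2 * pi * t)) w))"
    and int: "\<And>w. w \<in> S \<Longrightarrow> ((\<lambda>t. F (rotate_coord j (cis (2 * pi * t)) w)) has_integral L w) {0..1}"
  shows "set_integrable lborel S L" "(LINT w:S|lborel. F w) = (LINT w:S|lborel. L w)"
proof -
  define G where "G = (\<lambda>w. indicator S w *\<^sub>R F w)"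
  have G: "integrable lborel G" using F by (simp add: set_integrable_def G_def)
  have Gm[measurable]: "G \<in> borel_measurable borel" using borel_measurable_integrable[OF G] by simp
  define T where "T = (\<lambda>t. rotate_coord j (cis (2 * pi * t)) :: complex ^ 'n \<Rightarrow> complex ^ 'n)"
  have Tm: "(\<lambda>(t, w). T t w) \<in> borel_measurable (borel \<Otimes>\<^sub>M borel)"
  proof -
    have "continuous_on UNIV (\<lambda>x :: real \<times> (complex ^ 'n).
        if i = j then cis (2 * pi * fst x) * snd x $ i else snd x $ i)" for i
      by (cases "i = j") (auto intro!: continuous_intros)
    then have "(\<lambda>x. T (fst x) (snd x)) \<in> borel_measurable borel"
      unfolding T_def rotate_coord_def
      by (intro borel_measurable_continuous_onI continuous_on_vec_lambda)
    then show ?thesis by (simp add: borel_prod split_beta)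
  qed
  have Tm1[measurable]: "T t \<in> borel_measurable borel" for t
    using measurable_compose[OF _ Tm, of "\<lambda>w. (t, w)" borel] by simp
  have distrT: "distr lborel borel (T t) = lborel" for t
    unfolding T_def by (rule lborel_distr_rotate_coord) simp
  have GT: "integrable lborel (\<lambda>w. G (T t w))" for t
    using integrable_distr_eq[of "T t" lborel borel G] distrT[of t] G by simp
  have intGT: "(\<integral>w. g (T t w) \<partial>lborel) = (\<integral>w. g w \<partial>lborel)"
    if "g \<in> borel_measurable borel" for t and g :: "complex ^ 'n \<Rightarrow> 'z::{banach,second_countable_topology}"
    using integral_distr[of "T t" lborel borel g] distrT[of t] that by simp
  define H where "H = (\<lambda>(t, w). indicator {0..1::real} t *\<^sub>R G (T t w))"
  have Hm: "H \<in> borel_measurable (lborel \<Otimes>\<^sub>M lborel)"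
    unfolding H_def using measurable_compose[OF Tm Gm] by (simp add: split_beta)
  have H: "integrable (lborel \<Otimes>\<^sub>M lborel) H"
  proof (rule lborel_pair.Fubini_integrable[OF Hm])
    have "(\<integral>w. norm (H (t, w)) \<partial>lborel) = indicator {0..1} t * (\<integral>w. norm (G w) \<partial>lborel)" for t
      using intGT[of "\<lambda>w. norm (G w)" t] by (simp add: H_def)
    then show "integrable lborel (\<lambda>t. \<integral>w. norm (H (t, w)) \<partial>lborel)" by simp
    show "AE t in lborel. integrable lborel (\<lambda>w. H (t, w))"
      using GT by (simp add: H_def)
  qed
  have swap: "integrable (lborel \<Otimes>\<^sub>M lborel) (\<lambda>(w, t). H (t, w))"
    by (rule lborel_pair.integrable_product_swap[OF H])
  have inner: "(\<integral>t. H (t, w) \<partial>lborel) = indicator S w *\<^sub>R L w" for w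
  proof (cases "w \<in> S")
    case True
    have "G (T t w) = F (T t w)" for t
      using True inv by (simp add: G_def T_def)
    then have "(\<integral>t. H (t, w) \<partial>lborel) = (LINT t:{0..1}|lborel. F (T t w))"
      by (simp add: H_def set_lebesgue_integral_def)
    also have "\<dots> = integral {0..1} (\<lambda>t. F (T t w))"
      using cont[OF True] by (intro set_borel_integral_eq_integral(2) borel_integrable_atLeastAtMost') (simp add: T_def)
    also have "\<dots> = L w"
      using int[OF True] by (auto simp: T_def)
    finally show ?thesis using True by simp
  next
    case False
    then have "G (T t w) = 0" for t using inv by (simp add: G_def T_def)
    then show ?thesis using False by (simp add: H_def)
  qed
  show "set_integrable lborel S L"
    using lborel_pair.integrable_fst'[OF swap] by (simp add: set_integrable_def inner)
  have "(LINT w:S|lborel. L w) = (\<integral>w. (\<integral>t. H (t, w) \<partial>lborel) \<partial>lborel)"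
    by (simp add: set_lebesgue_integral_def inner)
  also have "\<dots> = (\<integral>t. (\<integral>w. H (t, w) \<partial>lborel) \<partial>lborel)"
    using lborel_pair.Fubini_integral[of "\<lambda>t w. H (t, w)"] H by simp
  also have "\<dots> = (\<integral>t. indicator {0..1::real} t *\<^sub>R (\<integral>w. G w \<partial>lborel) \<partial>lborel)"
    using intGT[OF Gm] by (simp add: H_def)
  also have "\<dots> = (\<integral>w. G w \<partial>lborel)"
    by simp
  finally show "(LINT w:S|lborel. F w) = (LINT w:S|lborel. L w)"
    by (simp add: set_lebesgue_integral_def G_def)
qed

section \<open>Bergman functions integrated against monomials\<close>

text \<open>
  Replacement of the coordinate with index \<open>j\<close> by \<open>a\<close>, and of all coordinates with index in \<open>J\<close> by \<open>0\<close>.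
\<close>

definition set_coord :: "'n::finite \<Rightarrow> complex \<Rightarrow> complex ^ 'n \<Rightarrow> complex ^ 'n" where
  "set_coord j a w = (\<chi> i. if i = j then a else w $ i)"

definition zero_coords :: "'n::finite set \<Rightarrow> complex ^ 'n \<Rightarrow> complex ^ 'n" where
  "zero_coords J w = (\<chi> i. if i \<in> J then 0 else w $ i)"

lemma set_coord_nth: "set_coord j a w $ i = (if i = j then a else w $ i)"
  by (simp add: set_coord_def)

lemma zero_coords_nth: "zero_coords J w $ i = (if i \<in> J then 0 else w $ i)"
  by (simp add: zero_coords_def)

lemma rotate_coord_eq_set_coord: "rotate_coord j c w = set_coord j (c * w $ j) w"
  by (simp add: vec_eq_iff rotate_coord_nth set_coord_nth)

lemma mholomorphic_on_imp_continuous_on: "f mholomorphic_on S \<Longrightarrow> continuous_on S f"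
  unfolding mholomorphic_on_def
  by (meson continuous_at_imp_continuous_on has_derivative_continuous)

lemma mholomorphic_on_slice:
  assumes "f mholomorphic_on S"
  shows "(\<lambda>a. f (set_coord j a w)) holomorphic_on {a. set_coord j a w \<in> S}"
proof (rule holomorphic_onI, clarsimp)
  fix a assume "set_coord j a w \<in> S"
  then obtain D where D: "(f has_derivative D) (at (set_coord j a w))" "\<And>c v. D (c *s v) = c * D v"
    using assms unfolding mholomorphic_on_def by blast
  have eq: "(\<lambda>b. set_coord j b w) = (\<lambda>b. set_coord j 0 w + axis j b)"
    by (auto simp: fun_eq_iff vec_eq_iff set_coord_nth axis_def)
  have "linear (axis j :: complex \<Rightarrow> complex ^ 'a)"
    by (rule linearI) (auto simp: vec_eq_iff axis_def)
  then have "bounded_linear (axis j :: complex \<Rightarrow> complex ^ 'a)"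
    by (simp add: linear_conv_bounded_linear)
  then have "((\<lambda>b. set_coord j b w) has_derivative axis j) (at a)"
    unfolding eq using has_derivative_add[OF has_derivative_const bounded_linear_imp_has_derivative] by fastforce
  from has_derivative_compose[OF this D(1)]
  have "((\<lambda>b. f (set_coord j b w)) has_derivative (\<lambda>v. D (axis j v))) (at a)" .
  moreover have "(\<lambda>v. D (axis j v)) = (*) (D (axis j 1))"
  proof
    fix v :: complex
    have "axis j v = v *s axis j 1" by (auto simp: vec_eq_iff axis_def)
    then have "D (axis j v) = D (v *s axis j 1)" by (rule arg_cong)
    then show "D (axis j v) = D (axis j 1) * v" by (simp only: D(2) mult.commute)
  qed
  ultimately have "((\<lambda>b. f (set_coord j b w)) has_field_derivative D (axis j 1)) (at a)"
    by (simp only: has_field_derivative_def)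
  then have "(\<lambda>a. f (set_coord j a w)) field_differentiable at a"
    unfolding field_differentiable_def by (rule exI)
  then show "(\<lambda>a. f (set_coord j a w)) field_differentiable at a within {a. set_coord j a w \<in> S}"
    by (rule field_differentiable_at_within)
qed

text \<open>
  The domain is stable under decreasing the moduli of the coordinates other than \<open>w\<^sub>k\<close>. In
  particular its slices in these coordinates are discs about \<open>0\<close>.
\<close>

lemma hartogs_domain_mono:
  assumes "w \<in> hartogs_domain k" "cmod (v $ k) = cmod (w $ k)" "\<And>i. i \<noteq> k \<Longrightarrow> cmod (v $ i) \<le> cmod (w $ i)"
  shows "v \<in> hartogs_domain k"
proof -
  have "cmod (v $ i) < 1" for i
    using assms le_less_trans[of "cmod (v $ i)" "cmod (w $ i)" 1]
    by (cases "i = k") (auto simp: hartogs_domain_def polydisc_def)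
  moreover have "(\<Prod>j\<in>-{k}. cmod (v $ j)) \<le> (\<Prod>j\<in>-{k}. cmod (w $ j))"
    using assms by (intro prod_mono) auto
  ultimately show ?thesis
    using assms by (auto simp: hartogs_domain_def polydisc_def prod_norm[symmetric])
qed

lemma rotate_coord_in_hartogs_domain_iff:
  "rotate_coord j (cis t) w \<in> hartogs_domain k \<longleftrightarrow> w \<in> hartogs_domain k"
  using hartogs_domain_mono[of w k "rotate_coord j (cis t) w"]
    hartogs_domain_mono[of "rotate_coord j (cis t) w" k w]
  by (auto simp: rotate_coord_nth norm_mult)

lemma set_coord_in_hartogs_domain:
  "w \<in> hartogs_domain k \<Longrightarrow> j \<noteq> k \<Longrightarrow> cmod a \<le> cmod (w $ j) \<Longrightarrow> set_coord j a w \<in> hartogs_domain k"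
  by (rule hartogs_domain_mono) (auto simp: set_coord_nth)

lemma zero_coords_in_hartogs_domain:
  "w \<in> hartogs_domain k \<Longrightarrow> k \<notin> J \<Longrightarrow> zero_coords J w \<in> hartogs_domain k"
  by (rule hartogs_domain_mono) (auto simp: zero_coords_nth)

text \<open>
  The mean value property in a coordinate other than \<open>w\<^sub>k\<close>, integrated against a weight that is
  invariant under the rotations of that coordinate.
\<close>

lemma integral_mean_value_coord:
  fixes f \<Phi> :: "complex ^ 'n::finite \<Rightarrow> complex"
  assumes hol: "\<And>w. w \<in> hartogs_domain k \<Longrightarrow> (\<lambda>a. f (set_coord j a w)) holomorphic_on cball 0 (cmod (w $ j))"
    and inv: "\<And>t w. \<Phi> (rotate_coord j (cis t) w) = \<Phi> w"
    and int: "set_integrable lborel (hartogs_domain k) (\<lambda>w. f w * \<Phi> w)"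
  shows "set_integrable lborel (hartogs_domain k) (\<lambda>w. f (set_coord j 0 w) * \<Phi> w)"
    and "(LINT w:hartogs_domain k|lborel. f w * \<Phi> w)
       = (LINT w:hartogs_domain k|lborel. f (set_coord j 0 w) * \<Phi> w)"
proof -
  have cont: "continuous_on {0..1} (\<lambda>t. f (rotate_coord j (cis (2 * pi * t)) w) * \<Phi> (rotate_coord j (cis (2 * pi * t)) w))"
    if "w \<in> hartogs_domain k" for w
    unfolding inv unfolding rotate_coord_eq_set_coord
    by (intro continuous_intros continuous_on_compose2[OF holomorphic_on_imp_continuous_on[OF hol[OF that]]])
       (auto simp: norm_mult)
  have mean: "((\<lambda>t. f (rotate_coord j (cis (2 * pi * t)) w) * \<Phi> (rotate_coord j (cis (2 * pi * t)) w))
        has_integral f (set_coord j 0 w) * \<Phi> w) {0..1}" if "w \<in> hartogs_domain k" for w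
    unfolding inv unfolding rotate_coord_eq_set_coord
    by (intro has_integral_mult_left holomorphic_mean_value_circle[of "\<lambda>a. f (set_coord j a w)"] hol that)
  note avg = set_integral_rotation_average[OF int rotate_coord_in_hartogs_domain_iff cont mean]
  show "set_integrable lborel (hartogs_domain k) (\<lambda>w. f (set_coord j 0 w) * \<Phi> w)"
    and "(LINT w:hartogs_domain k|lborel. f w * \<Phi> w)
       = (LINT w:hartogs_domain k|lborel. f (set_coord j 0 w) * \<Phi> w)"
    using avg by blast+
qed

lemma integral_mean_value_coords:
  fixes f \<Phi> :: "complex ^ 'n::finite \<Rightarrow> complex"
  assumes f: "f mholomorphic_on hartogs_domain k"
    and inv: "\<And>j t w. j \<noteq> k \<Longrightarrow> \<Phi> (rotate_coord j (cis t) w) = \<Phi> w"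
    and int: "set_integrable lborel (hartogs_domain k) (\<lambda>w. f w * \<Phi> w)"
    and J: "k \<notin> J"
  shows "set_integrable lborel (hartogs_domain k) (\<lambda>w. f (zero_coords J w) * \<Phi> w)
    \<and> (LINT w:hartogs_domain k|lborel. f w * \<Phi> w)
       = (LINT w:hartogs_domain k|lborel. f (zero_coords J w) * \<Phi> w)"
  using finite[of J] J
proof (induction J rule: finite_induct)
  case empty
  have "zero_coords {} = (\<lambda>w :: complex ^ 'n. w)" by (simp add: fun_eq_iff vec_eq_iff zero_coords_nth)
  then show ?case using int by simp
next
  case (insert j J)
  have "j \<noteq> k" using insert.prems by auto
  have sz: "zero_coords J (set_coord j a w) = set_coord j a (zero_coords J w)" for a and w :: "complex ^ 'n"
    using insert.hyps by (auto simp: vec_eq_iff zero_coords_nth set_coord_nth)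
  have zi: "set_coord j 0 (zero_coords J w) = zero_coords (insert j J) w" for w :: "complex ^ 'n"
    by (auto simp: vec_eq_iff zero_coords_nth set_coord_nth)
  have hol: "(\<lambda>a. f (zero_coords J (set_coord j a w))) holomorphic_on cball 0 (cmod (w $ j))"
    if "w \<in> hartogs_domain k" for w
    unfolding sz
  proof (rule holomorphic_on_subset[OF mholomorphic_on_slice[OF f]], clarsimp)
    fix a assume "cmod a \<le> cmod (w $ j)"
    then have "set_coord j a w \<in> hartogs_domain k"
      using that \<open>j \<noteq> k\<close> by (intro set_coord_in_hartogs_domain) auto
    then show "set_coord j a (zero_coords J w) \<in> hartogs_domain k"
      unfolding sz[symmetric] using insert.prems by (intro zero_coords_in_hartogs_domain) auto
  qed
  have IH: "set_integrable lborel (hartogs_domain k) (\<lambda>w. f (zero_coords J w) * \<Phi> w)"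
    "(LINT w:hartogs_domain k|lborel. f w * \<Phi> w) = (LINT w:hartogs_domain k|lborel. f (zero_coords J w) * \<Phi> w)"
    using insert by auto
  from integral_mean_value_coord[of k "\<lambda>w. f (zero_coords J w)" j \<Phi>, OF hol inv[OF \<open>j \<noteq> k\<close>] IH(1)]
  show ?case unfolding IH(2) sz zi by simp
qed

text \<open>
  Here \<open>C\<close> is the Laurent coefficient of index \<open>d\<close> of \<open>g\<close>. It is important that the same \<open>C\<close> serves all
  weights \<open>\<Phi>\<close>.
\<close>

lemma integral_laurent_coefficient:
  assumes g: "g holomorphic_on ball 0 1 - {0}"
  shows "\<exists>C. \<forall>\<Phi>. (\<forall>t w. \<Phi> (rotate_coord k (cis t) w) * cis t ^ d = \<Phi> w) \<longrightarrow>
    set_integrable lborel (hartogs_domain (k::'n::finite)) (\<lambda>w. g (w $ k) * \<Phi> w) \<longrightarrow>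
    (LINT w:hartogs_domain k|lborel. g (w $ k) * \<Phi> w)
      = C * (LINT w:hartogs_domain k|lborel. w $ k ^ d * \<Phi> w)"
proof -
  \<comment> \<open>dividing by \<open>a\<^sup>d\<close> moves the coefficient of index \<open>d\<close> to index \<open>0\<close>\<close>
  define h where "h = (\<lambda>a. g a / a ^ d)"
  have h: "h holomorphic_on ball 0 1 - {0}"
    unfolding h_def using g by (intro holomorphic_intros) auto
  from holomorphic_mean_value_punctured_disc[OF h]
  obtain C where C: "\<And>a. a \<noteq> 0 \<Longrightarrow> cmod a < 1 \<Longrightarrow> ((\<lambda>t. h (cis (2 * pi * t) * a)) has_integral C) {0..1}"
    by blast
  show ?thesis
  proof (intro exI[of _ C] allI impI)
    fix \<Phi> :: "complex ^ 'n \<Rightarrow> complex"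
    assume \<Phi>: "\<forall>t w. \<Phi> (rotate_coord k (cis t) w) * cis t ^ d = \<Phi> w"
      and int: "set_integrable lborel (hartogs_domain k) (\<lambda>w. g (w $ k) * \<Phi> w)"
    have wk: "w $ k \<noteq> 0" "cmod (w $ k) < 1" if "w \<in> hartogs_domain k" for w :: "complex ^ 'n"
      using that norm_ge_zero[of "\<Prod>j\<in>-{k}. w $ j"] by (auto simp: hartogs_domain_def polydisc_def)
    have eq: "g (rotate_coord k (cis s) w $ k) * \<Phi> (rotate_coord k (cis s) w)
        = h (cis s * w $ k) * (w $ k ^ d * \<Phi> w)" if "w \<in> hartogs_domain k" for s w
    proof -
      have "h (cis s * w $ k) * (w $ k ^ d * \<Phi> w)
          = h (cis s * w $ k) * (cis s * w $ k) ^ d * \<Phi> (rotate_coord k (cis s) w)"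
        unfolding \<Phi>[rule_format, of s w, symmetric] by (simp add: power_mult_distrib mult_ac)
      also have "h (cis s * w $ k) * (cis s * w $ k) ^ d = g (rotate_coord k (cis s) w $ k)"
        using wk[OF that] by (simp add: h_def rotate_coord_nth)
      finally show ?thesis ..
    qed
    have "(LINT w:hartogs_domain k|lborel. g (w $ k) * \<Phi> w)
        = (LINT w:hartogs_domain k|lborel. C * (w $ k ^ d * \<Phi> w))"
    proof (rule set_integral_rotation_average(2)[OF int rotate_coord_in_hartogs_domain_iff])
      fix w :: "complex ^ 'n" assume w: "w \<in> hartogs_domain k"
      show "continuous_on {0..1} (\<lambda>t. g (rotate_coord k (cis (2 * pi * t)) w $ k) * \<Phi> (rotate_coord k (cis (2 * pi * t)) w))"
        unfolding eq[OF w] using wk[OF w]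
        by (intro continuous_intros continuous_on_compose2[OF holomorphic_on_imp_continuous_on[OF h]])
           (auto simp: norm_mult)
      show "((\<lambda>t. g (rotate_coord k (cis (2 * pi * t)) w $ k) * \<Phi> (rotate_coord k (cis (2 * pi * t)) w))
          has_integral C * (w $ k ^ d * \<Phi> w)) {0..1}"
        unfolding eq[OF w] by (intro has_integral_mult_left C wk[OF w])
    qed
    then show "(LINT w:hartogs_domain k|lborel. g (w $ k) * \<Phi> w)
        = C * (LINT w:hartogs_domain k|lborel. w $ k ^ d * \<Phi> w)"
      by simp
  qed
qed

text \<open>
  The monomial \<open>w\<^sup>\<beta>\<close> with exponents \<open>\<beta>\<^sub>i\<close>.
\<close>

definition vec_monom :: "('n::finite \<Rightarrow> nat) \<Rightarrow> complex ^ 'n \<Rightarrow> complex" where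
  "vec_monom \<beta> w = (\<Prod>i\<in>UNIV. w $ i ^ \<beta> i)"

lemma cis_power_cnj: "cis t ^ n * cnj (cis t ^ n) = 1"
  using complex_norm_square[of "cis t ^ n"] by (simp add: norm_power)

lemma vec_monom_rotate_coord: "vec_monom \<beta> (rotate_coord j c w) = c ^ \<beta> j * vec_monom \<beta> w"
proof -
  have "vec_monom \<beta> (rotate_coord j c w) = (\<Prod>i\<in>UNIV. (if i = j then c ^ \<beta> j else 1) * w $ i ^ \<beta> i)"
    unfolding vec_monom_def by (intro prod.cong) (auto simp: rotate_coord_nth power_mult_distrib)
  then show ?thesis by (simp add: prod.distrib vec_monom_def)
qed

lemma vec_monom_split: "vec_monom \<beta> w = w $ j ^ \<beta> j * (\<Prod>i\<in>-{j}. w $ i ^ \<beta> i)"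
  unfolding vec_monom_def by (subst prod.remove[of _ j]) (auto simp: Compl_eq_Diff_UNIV)

lemma vec_monom_single: "vec_monom (\<lambda>i. if i = k then d else 0) w = w $ k ^ d"
  unfolding vec_monom_split[of _ w k] by simp

lemma cmod_vec_monom_le_1: "w \<in> hartogs_domain k \<Longrightarrow> cmod (vec_monom \<beta> w) \<le> 1"
  unfolding vec_monom_def prod_norm[symmetric]
  by (intro prod_le_1) (auto simp: norm_power power_le_one less_imp_le hartogs_domain_def polydisc_def)

lemma continuous_on_vec_monom: "continuous_on S (vec_monom \<beta>)"
  unfolding vec_monom_def by (intro continuous_intros)

lemma emeasure_hartogs_domain_finite: "emeasure lborel (hartogs_domain k) < \<infinity>"
  using nn_integral_hartogs_domain_power[of k 0] borel_open[OF open_hartogs_domain[of k]] by simp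

lemma set_integrable_bergman_times_monoms:
  assumes "f \<in> bergman_space (hartogs_domain k)"
  shows "set_integrable lborel (hartogs_domain k) (\<lambda>w. f w * (vec_monom \<beta> w * cnj (vec_monom \<gamma> w)))"
proof -
  let ?H = "hartogs_domain k"
  have H: "?H \<in> sets borel" by (rule borel_open[OF open_hartogs_domain])
  have f: "continuous_on ?H f" "set_integrable lborel ?H (\<lambda>z. (cmod (f z))\<^sup>2)"
    using assms mholomorphic_on_imp_continuous_on by (auto simp: bergman_space_def)
  have one: "set_integrable lborel ?H (\<lambda>_. 1 :: real)"
    using emeasure_hartogs_domain_finite[of k] H by (simp add: set_integrable_def)
  show ?thesis
    unfolding set_integrable_def
  proof (rule Bochner_Integration.integrable_bound)
    show "integrable lborel (\<lambda>w. indicator ?H w *\<^sub>R (1 + (cmod (f w))\<^sup>2))"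
      using set_integral_add(1)[OF one f(2)] by (simp add: set_integrable_def)
    have "continuous_on ?H (\<lambda>w. f w * (vec_monom \<beta> w * cnj (vec_monom \<gamma> w)))"
      by (intro continuous_intros f continuous_on_vec_monom)
    then show "(\<lambda>w. indicator ?H w *\<^sub>R (f w * (vec_monom \<beta> w * cnj (vec_monom \<gamma> w)))) \<in> borel_measurable lborel"
      using borel_measurable_continuous_on_indicator[OF H] by simp
    have "norm (f w * (vec_monom \<beta> w * cnj (vec_monom \<gamma> w))) \<le> 1 + (cmod (f w))\<^sup>2" if "w \<in> ?H" for w
    proof -
      have "cmod (vec_monom \<beta> w) * cmod (vec_monom \<gamma> w) \<le> 1"
        using cmod_vec_monom_le_1[OF that] by (intro mult_le_one) auto
      then have "cmod (f w) * (cmod (vec_monom \<beta> w) * cmod (vec_monom \<gamma> w)) \<le> cmod (f w) * 1"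
        by (intro mult_left_mono) auto
      also have "\<dots> \<le> 1 + (cmod (f w))\<^sup>2"
      proof -
        have "2 * cmod (f w) \<le> 1 + (cmod (f w))\<^sup>2"
          using zero_le_power2[of "cmod (f w) - 1"] unfolding power2_diff by simp
        then show ?thesis using norm_ge_zero[of "f w"] by linarith
      qed
      finally show ?thesis by (simp add: norm_mult)
    qed
    then show "AE w in lborel. norm (indicator ?H w *\<^sub>R (f w * (vec_monom \<beta> w * cnj (vec_monom \<gamma> w))))
        \<le> norm (indicator ?H w *\<^sub>R (1 + (cmod (f w))\<^sup>2))"
      by (auto simp: indicator_def)
  qed
qed

text \<open>
  In terms of Laurent expansions: \<open>w\<^sup>\<beta> f\<close> has no terms of degree less than \<open>\<beta>\<^sub>j\<close> in \<open>w\<^sub>j\<close>, as \<open>f\<close> is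
  holomorphic in \<open>w\<^sub>j\<close> on a disc about \<open>0\<close>.
\<close>

lemma integral_bergman_times_monoms_eq_0:
  assumes f: "f \<in> bergman_space (hartogs_domain k)" and j: "j \<noteq> k" "\<gamma> j < \<beta> j"
  shows "(LINT w:hartogs_domain k|lborel. f w * (vec_monom \<beta> w * cnj (vec_monom \<gamma> w))) = 0"
proof -
  define n where "n = \<beta> j - \<gamma> j"
  define \<Phi> where "\<Phi> = (\<lambda>w. vec_monom (\<beta>(j := \<gamma> j)) w * cnj (vec_monom \<gamma> w))"
  have eq: "f w * (vec_monom \<beta> w * cnj (vec_monom \<gamma> w)) = (f w * w $ j ^ n) * \<Phi> w" for w
  proof -
    have "vec_monom \<beta> w = w $ j ^ n * vec_monom (\<beta>(j := \<gamma> j)) w"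
      unfolding vec_monom_split[of _ w j] using j by (simp add: n_def power_add[symmetric] mult.assoc[symmetric])
    then show ?thesis by (simp add: \<Phi>_def)
  qed
  have fm: "f mholomorphic_on hartogs_domain k" using f by (simp add: bergman_space_def)
  have hol: "(\<lambda>a. f (set_coord j a w) * set_coord j a w $ j ^ n) holomorphic_on cball 0 (cmod (w $ j))"
    if "w \<in> hartogs_domain k" for w
    unfolding set_coord_nth
    by (intro holomorphic_intros holomorphic_on_subset[OF mholomorphic_on_slice[OF fm]])
       (auto intro: set_coord_in_hartogs_domain[OF that j(1)] simp: holomorphic_on_const)
  have inv: "\<Phi> (rotate_coord j (cis t) w) = \<Phi> w" for t w
  proof -
    have "\<Phi> (rotate_coord j (cis t) w) = (cis t ^ \<gamma> j * cnj (cis t ^ \<gamma> j)) * \<Phi> w"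
      by (simp add: \<Phi>_def vec_monom_rotate_coord mult_ac)
    then show ?thesis by (simp only: cis_power_cnj) simp
  qed
  have "(LINT w:hartogs_domain k|lborel. (f w * w $ j ^ n) * \<Phi> w)
      = (LINT w:hartogs_domain k|lborel. (f (set_coord j 0 w) * set_coord j 0 w $ j ^ n) * \<Phi> w)"
    using set_integrable_bergman_times_monoms[OF f, of \<beta> \<gamma>]
    by (intro integral_mean_value_coord(2)[OF hol inv]) (simp_all add: eq)
  also have "\<dots> = 0" using j by (simp add: set_coord_nth n_def zero_power)
  finally show ?thesis by (simp add: eq)
qed

lemma other_coordinates_nonempty:
  assumes "CARD('n::finite) \<ge> 2"
  shows "- {k::'n} \<noteq> {}"
proof
  assume "- {k} = {}"
  then have "UNIV = {k}" by auto
  then have "CARD('n) = card {k}" by (rule arg_cong)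
  with assms show False by simp
qed

text \<open>
  The numbers \<open>C d\<close> are the Laurent coefficients of the restriction of \<open>f\<close> to the axis of the coordinate
  \<open>w\<^sub>k\<close>. That the exponents agree off \<open>k\<close> makes the weight invariant under the rotations of all other
  coordinates, so that the mean value property sets these coordinates to \<open>0\<close> in \<open>f\<close>.
\<close>

lemma integral_bergman_times_monoms:
  assumes f: "f \<in> bergman_space (hartogs_domain (k::'n::finite))" and n: "CARD('n) \<ge> 2"
  shows "\<exists>C::nat \<Rightarrow> complex. \<forall>\<beta> \<gamma>. (\<forall>j. j \<noteq> k \<longrightarrow> \<beta> j = \<gamma> j) \<longrightarrow> \<beta> k \<le> \<gamma> k \<longrightarrow>
      (LINT w:hartogs_domain k|lborel. f w * (vec_monom \<beta> w * cnj (vec_monom \<gamma> w)))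
        = C (\<gamma> k - \<beta> k) * (LINT w:hartogs_domain k|lborel. vec_monom \<gamma> w * cnj (vec_monom \<gamma> w))"
proof -
  have fm: "f mholomorphic_on hartogs_domain k" using f by (simp add: bergman_space_def)
  define g where "g = (\<lambda>a. f (axis k a))"
  have zero: "zero_coords (-{k}) w = axis k (w $ k)" for w :: "complex ^ 'n"
    by (auto simp: vec_eq_iff zero_coords_nth axis_def)
  have "set_coord k a 0 = axis k a" for a
    by (auto simp: vec_eq_iff set_coord_nth axis_def)
  then have "g holomorphic_on {a. axis k a \<in> hartogs_domain k}"
    using mholomorphic_on_slice[OF fm, of k 0] by (simp add: g_def)
  moreover have "ball 0 1 - {0} \<subseteq> {a. axis k a \<in> hartogs_domain k}"
  proof -
    have "0 < card (- {k})" using other_coordinates_nonempty[OF n, of k] by (simp add: card_gt_0_iff)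
    then show ?thesis by (auto simp: hartogs_domain_def polydisc_def axis_def zero_power)
  qed
  ultimately have g: "g holomorphic_on ball 0 1 - {0}" by (rule holomorphic_on_subset)
  have "\<forall>d. \<exists>C. \<forall>\<Phi>. (\<forall>t w. \<Phi> (rotate_coord k (cis t) w) * cis t ^ d = \<Phi> w) \<longrightarrow>
    set_integrable lborel (hartogs_domain k) (\<lambda>w. g (w $ k) * \<Phi> w) \<longrightarrow>
    (LINT w:hartogs_domain k|lborel. g (w $ k) * \<Phi> w)
      = C * (LINT w:hartogs_domain k|lborel. w $ k ^ d * \<Phi> w)"
    by (intro allI integral_laurent_coefficient[OF g])
  from choice[OF this] obtain C where C: "\<And>d \<Phi>. (\<And>t w. \<Phi> (rotate_coord k (cis t) w) * cis t ^ d = \<Phi> w) \<Longrightarrow>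
    set_integrable lborel (hartogs_domain k) (\<lambda>w. g (w $ k) * \<Phi> w) \<Longrightarrow>
    (LINT w:hartogs_domain k|lborel. g (w $ k) * \<Phi> w)
      = C d * (LINT w:hartogs_domain k|lborel. w $ k ^ d * \<Phi> w)"
    by blast
  show ?thesis
  proof (intro exI[of _ C] allI impI)
    fix \<beta> \<gamma> :: "'n \<Rightarrow> nat"
    assume eq: "\<forall>j. j \<noteq> k \<longrightarrow> \<beta> j = \<gamma> j" and le: "\<beta> k \<le> \<gamma> k"
    define \<Phi> where "\<Phi> = (\<lambda>w. vec_monom \<beta> w * cnj (vec_monom \<gamma> w))"
    have inv: "\<Phi> (rotate_coord j (cis t) w) = \<Phi> w" if "j \<noteq> k" for j t w
    proof -
      have "\<Phi> (rotate_coord j (cis t) w) = (cis t ^ \<gamma> j * cnj (cis t ^ \<gamma> j)) * \<Phi> w"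
        using eq that by (simp add: \<Phi>_def vec_monom_rotate_coord mult_ac)
      then show ?thesis by (simp only: cis_power_cnj) simp
    qed
    have int: "set_integrable lborel (hartogs_domain k) (\<lambda>w. f w * \<Phi> w)"
      unfolding \<Phi>_def by (rule set_integrable_bergman_times_monoms[OF f])
    note red = integral_mean_value_coords[OF fm inv int, of "-{k}", unfolded zero, folded g_def]
    have eqk: "\<Phi> (rotate_coord k (cis t) w) * cis t ^ (\<gamma> k - \<beta> k) = \<Phi> w" for t w
    proof -
      have "cis t ^ \<beta> k * cis t ^ (\<gamma> k - \<beta> k) = cis t ^ \<gamma> k" using le by (simp add: power_add[symmetric])
      then have "\<Phi> (rotate_coord k (cis t) w) * cis t ^ (\<gamma> k - \<beta> k)
          = (cis t ^ \<gamma> k * cnj (cis t ^ \<gamma> k)) * \<Phi> w"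
        by (simp add: \<Phi>_def vec_monom_rotate_coord mult_ac)
      then show ?thesis by (simp only: cis_power_cnj) simp
    qed
    have monom: "w $ k ^ (\<gamma> k - \<beta> k) * \<Phi> w = vec_monom \<gamma> w * cnj (vec_monom \<gamma> w)" for w
    proof -
      have "(\<Prod>i\<in>-{k}. w $ i ^ \<beta> i) = (\<Prod>i\<in>-{k}. w $ i ^ \<gamma> i)" using eq by (intro prod.cong) auto
      moreover have "w $ k ^ (\<gamma> k - \<beta> k) * w $ k ^ \<beta> k = w $ k ^ \<gamma> k" using le by (simp add: power_add[symmetric])
      ultimately have "w $ k ^ (\<gamma> k - \<beta> k) * vec_monom \<beta> w = vec_monom \<gamma> w"
        unfolding vec_monom_split[of _ w k] by (simp only: mult.assoc[symmetric])
      then show ?thesis by (simp add: \<Phi>_def mult.assoc[symmetric])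
    qed
    have "(LINT w:hartogs_domain k|lborel. f w * \<Phi> w) = (LINT w:hartogs_domain k|lborel. g (w $ k) * \<Phi> w)"
      using red by (simp add: g_def)
    also have "\<dots> = C (\<gamma> k - \<beta> k) * (LINT w:hartogs_domain k|lborel. w $ k ^ (\<gamma> k - \<beta> k) * \<Phi> w)"
      using red by (intro C eqk) (simp add: g_def)
    finally show "(LINT w:hartogs_domain k|lborel. f w * (vec_monom \<beta> w * cnj (vec_monom \<gamma> w)))
        = C (\<gamma> k - \<beta> k) * (LINT w:hartogs_domain k|lborel. vec_monom \<gamma> w * cnj (vec_monom \<gamma> w))"
      unfolding monom by (simp add: \<Phi>_def)
  qed
qed

lemma set_integrable_monoms:
  "set_integrable lborel (hartogs_domain k) (\<lambda>w. vec_monom \<beta> w * cnj (vec_monom \<gamma> w))"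
proof -
  have "(\<lambda>_. 1) mholomorphic_on hartogs_domain k"
    unfolding mholomorphic_on_def by (intro ballI exI[of _ "\<lambda>_. 0"]) auto
  then have "(\<lambda>_. 1) \<in> bergman_space (hartogs_domain k)"
    using emeasure_hartogs_domain_finite[of k] borel_open[OF open_hartogs_domain[of k]]
    by (simp add: bergman_space_def set_integrable_def)
  from set_integrable_bergman_times_monoms[OF this] show ?thesis by simp
qed

lemma integral_monoms_orthogonal:
  assumes "\<beta> k < \<gamma> k"
  shows "(LINT w:hartogs_domain k|lborel. vec_monom \<beta> w * cnj (vec_monom \<gamma> w)) = 0"
proof -
  \<comment> \<open>\<open>F\<close> is the conjugate of the integrand, for which rotations give positive powers of \<open>cis t\<close>\<close>
  define F where "F = (\<lambda>w. vec_monom \<gamma> w * cnj (vec_monom \<beta> w))"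
  define d where "d = \<gamma> k - \<beta> k"
  have d: "d > 0" using assms by (simp add: d_def)
  have rot: "F (rotate_coord k (cis t) w) = (cis t * 1) ^ d * F w" for t w
  proof -
    have "cis t ^ \<gamma> k = cis t ^ d * cis t ^ \<beta> k" using assms by (simp add: d_def power_add[symmetric])
    then have "F (rotate_coord k (cis t) w) = cis t ^ d * (cis t ^ \<beta> k * cnj (cis t ^ \<beta> k)) * F w"
      by (simp add: F_def vec_monom_rotate_coord mult_ac)
    then show ?thesis by (simp only: cis_power_cnj) simp
  qed
  have "((\<lambda>t. (cis (2 * pi * t) * 1) ^ d) has_integral 0 ^ d) {0..1}"
    by (rule holomorphic_mean_value_circle[of "\<lambda>a. a ^ d"]) (intro holomorphic_intros)
  from has_integral_mult_left[OF this]
  have int: "((\<lambda>t. (cis (2 * pi * t) * 1) ^ d * F w) has_integral 0) {0..1}" for w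
    using d by (simp add: zero_power)
  have "(LINT w:hartogs_domain k|lborel. F w) = (LINT w:hartogs_domain k|lborel. 0)"
  proof (rule set_integral_rotation_average(2)[where j = k, OF _ rotate_coord_in_hartogs_domain_iff])
    show "set_integrable lborel (hartogs_domain k) F"
      unfolding F_def by (rule set_integrable_monoms)
  qed (unfold rot, intro continuous_intros, rule int)
  moreover have "(LINT w:hartogs_domain k|lborel. vec_monom \<beta> w * cnj (vec_monom \<gamma> w))
      = cnj (LINT w:hartogs_domain k|lborel. F w)"
    unfolding set_lebesgue_integral_def F_def
    by (subst Bochner_Integration.integral_cnj [symmetric])
       (auto intro!: Bochner_Integration.integral_cong simp: mult_ac scaleR_conv_of_real)
  ultimately show ?thesis by simp
qed

lemma vec_monom_mult_cnj: "vec_monom \<gamma> w * cnj (vec_monom \<gamma> w) = of_real ((cmod (vec_monom \<gamma> w))\<^sup>2)"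
  by (simp only: complex_norm_square)

lemma integral_vec_monom_square_nonzero:
  assumes "CARD('n::finite) \<ge> 2"
  shows "(LINT w:hartogs_domain (k::'n)|lborel. vec_monom \<gamma> w * cnj (vec_monom \<gamma> w)) \<noteq> 0"
proof
  let ?H = "hartogs_domain k"
  assume 0: "(LINT w:?H|lborel. vec_monom \<gamma> w * cnj (vec_monom \<gamma> w)) = 0"
  have eq: "indicator ?H w *\<^sub>R (vec_monom \<gamma> w * cnj (vec_monom \<gamma> w))
      = of_real (indicator ?H w * (cmod (vec_monom \<gamma> w))\<^sup>2)" for w
    unfolding vec_monom_mult_cnj by (simp add: scaleR_conv_of_real)
  have "integrable lborel (\<lambda>w. complex_of_real (indicator ?H w * (cmod (vec_monom \<gamma> w))\<^sup>2))"
    using set_integrable_monoms[of k \<gamma> \<gamma>] by (simp only: set_integrable_def eq)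
  from integrable_Re[OF this]
  have int: "integrable lborel (\<lambda>w. indicator ?H w * (cmod (vec_monom \<gamma> w))\<^sup>2)"
    by (simp only: Re_complex_of_real)
  have "(\<integral>w. indicator ?H w * (cmod (vec_monom \<gamma> w))\<^sup>2 \<partial>lborel) = 0"
    using 0 by (simp only: set_lebesgue_integral_def eq integral_complex_of_real of_real_eq_0_iff)
  then have ae: "AE w in lborel. indicator ?H w * (cmod (vec_monom \<gamma> w))\<^sup>2 = 0"
    by (subst (asm) integral_nonneg_eq_0_iff_AE[OF int]) auto
  define U where "U = {w \<in> ?H. \<forall>i. w $ i \<noteq> 0}"
  from ae have "AE w in lborel. w \<notin> U"
    by eventually_elim (auto simp: U_def vec_monom_def prod_zero_iff)
  have "U = ?H \<inter> (\<Inter>i. {w. w $ i \<noteq> 0})" by (auto simp: U_def)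
  also have "open \<dots>"
    by (intro open_Int open_hartogs_domain open_INT ballI open_Collect_neq continuous_intros) simp
  finally have "open U" .
  with \<open>AE w in lborel. w \<notin> U\<close> have "U \<in> null_sets lborel"
    by (subst (asm) AE_iff_null_sets[symmetric]) (auto simp: borel_open)
  then have "negligible U" using negligible_iff_null_sets null_sets_completionI by blast
  then have "U = {}" using \<open>open U\<close> open_not_negligible by blast
  \<comment> \<open>a point of the domain without zero coordinates\<close>
  moreover have "(\<chi> i. if i = k then 3 / 4 else 1 / 2) \<in> U"
  proof -
    from other_coordinates_nonempty[OF assms, of k] obtain j where j: "j \<in> -{k}" by blast
    have "(\<Prod>i\<in>-{k}. cmod (if i = k then 3 / 4 else 1 / 2)) = (\<Prod>i\<in>-{k}. 1 / 2 :: real)"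
      by (intro prod.cong) (auto simp: norm_divide)
    also have "\<dots> = 1 / 2 * (\<Prod>i\<in>-{k}-{j}. 1 / 2)" using j by (subst prod.remove[of _ j]) auto
    also have "\<dots> \<le> 1 / 2 * 1" by (intro mult_left_mono prod_le_1) auto
    finally show ?thesis
      by (auto simp: U_def hartogs_domain_def polydisc_def prod_norm[symmetric] norm_divide)
  qed
  ultimately show False by simp
qed

text \<open>
  The squared norm of \<open>w\<^sub>k\<^sup>d\<close>, with \<open>x = d + 2\<close>, in the form \<open>\<parallel>w\<^sub>k\<^sup>d\<parallel>\<^sup>2 x\<^sup>m = \<pi>\<^sup>n (1 + x + \<dots> + x\<^sup>m\<^sup>-\<^sup>1)\<close> for \<open>m = n - 1\<close>.
\<close>

lemma integral_coordinate_power: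
  fixes k :: "'n::finite" and d :: nat
  assumes "CARD('n) \<ge> 2"
  shows "(LINT w:hartogs_domain k|lborel. w $ k ^ d * cnj (w $ k ^ d)) * of_nat (d + 2) ^ (CARD('n) - 1)
      = of_real (pi ^ CARD('n)) * (\<Sum>l<CARD('n) - 1. of_nat (d + 2) ^ l)"
proof -
  let ?H = "hartogs_domain k" and ?m = "CARD('n) - 1"
  have H[measurable]: "?H \<in> sets borel" by (rule borel_open[OF open_hartogs_domain])
  define N where "N = pi ^ CARD('n) / (d + 1) * (1 - 1 / (d + 2) ^ ?m)"
  have "N \<ge> 0" unfolding N_def
    by (intro mult_nonneg_nonneg) (auto simp: divide_le_eq_1 intro!: one_le_power)
  have eq: "indicator ?H w *\<^sub>R (w $ k ^ d * cnj (w $ k ^ d)) = of_real (indicator ?H w * cmod (w $ k) ^ (2 * d))" for w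
    by (simp only: complex_norm_square[symmetric]) (simp add: scaleR_conv_of_real norm_power power_mult[symmetric] mult.commute)
  have "has_bochner_integral lborel (\<lambda>w. indicator ?H w * cmod (w $ k) ^ (2 * d)) N"
  proof (rule has_bochner_integral_nn_integral)
    show "(\<lambda>w. indicator ?H w * cmod (w $ k) ^ (2 * d)) \<in> borel_measurable lborel"
      by (intro borel_measurable_times borel_measurable_indicator)
         (auto intro!: borel_measurable_continuous_onI continuous_intros)
    have "ennreal (indicator ?H w * cmod (w $ k) ^ (2 * d)) = ennreal (cmod (w $ k) ^ (2 * d)) * indicator ?H w" for w
      by (auto simp: indicator_def)
    then show "(\<integral>\<^sup>+w. ennreal (indicator ?H w * cmod (w $ k) ^ (2 * d)) \<partial>lborel) = ennreal N"
      using nn_integral_hartogs_domain_power[of k d] by (simp add: N_def add.commute)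
  qed (use \<open>N \<ge> 0\<close> in auto)
  then have "(LINT w:?H|lborel. w $ k ^ d * cnj (w $ k ^ d)) = of_real N"
    by (simp only: set_lebesgue_integral_def eq integral_complex_of_real has_bochner_integral_integral_eq)
  moreover have "N * real (d + 2) ^ ?m = pi ^ CARD('n) * (\<Sum>l<?m. real (d + 2) ^ l)"
  proof -
    have "(real (d + 2)) ^ ?m - 1 = (real (d + 2) - 1) * (\<Sum>l<?m. real (d + 2) ^ l)"
      using power_diff_1_eq[of "real (d + 2)" ?m] by simp
    moreover have "real (d + 2) - 1 = real (d + 1)" by simp
    ultimately have geometric: "(real (d + 2)) ^ ?m - 1 = real (d + 1) * (\<Sum>l<?m. real (d + 2) ^ l)"
      by (simp only:)
    have "N * real (d + 2) ^ ?m = pi ^ CARD('n) / (d + 1) * (real (d + 2) ^ ?m - 1)"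
    proof -
      have cancel: "(1 - 1 / x) * x = x - 1" if "x > 0" for x :: real
        using that by (simp add: left_diff_distrib)
      have "(real (d + 2)) ^ ?m > 0" by simp
      from cancel[OF this] show ?thesis unfolding N_def by (simp only: mult.assoc of_nat_add of_nat_numeral of_nat_1 of_nat_power)
    qed
    then have "N * real (d + 2) ^ ?m
        = pi ^ CARD('n) / real (d + 1) * (real (d + 1) * (\<Sum>l<?m. real (d + 2) ^ l))"
      by (simp only: geometric)
    moreover have "c / x * (x * y) = c * y" if "x \<noteq> 0" for c x y :: real using that by simp
    ultimately show ?thesis by (simp del: of_nat_add)
  qed
  then have "complex_of_real (N * real (d + 2) ^ ?m) = of_real (pi ^ CARD('n) * (\<Sum>l<?m. real (d + 2) ^ l))"
    by (rule arg_cong)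
  ultimately show ?thesis by simp
qed

section \<open>Non-vanishing of polynomials\<close>

text \<open>
  A nonzero polynomial in the variables with index in \<open>I\<close> does not vanish on a product of infinite sets.
  Exponents are functions that are \<open>0\<close> outside of \<open>I\<close>. In the induction step the coefficient of
  one power of the new variable is a nonzero polynomial in the others.
\<close>

lemma polynomial_function_nonzero_on_grid:
  fixes c :: "('i \<Rightarrow> nat) \<Rightarrow> 'a::{idom}"
  assumes "finite I" "finite S" "\<And>m i. m \<in> S \<Longrightarrow> i \<notin> I \<Longrightarrow> m i = 0"
    and "m0 \<in> S" "c m0 \<noteq> 0" "\<And>i. i \<in> I \<Longrightarrow> infinite (X i)"
  shows "\<exists>x. (\<forall>i\<in>I. x i \<in> X i) \<and> (\<Sum>m\<in>S. c m * (\<Prod>i\<in>I. x i ^ m i)) \<noteq> 0"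
  using assms
proof (induction I arbitrary: S c m0 rule: finite_induct)
  case empty
  have "m = m0" if "m \<in> S" for m
    using empty.prems(2)[OF that] empty.prems(2)[OF empty.prems(3)] by auto
  then have "S = {m0}" using empty.prems(3) by blast
  then show ?case using empty.prems by simp
next
  case (insert j I)
  define S' where "S' = (\<lambda>m. m(j := 0)) ` {m\<in>S. m j = m0 j}"
  define c' where "c' = (\<lambda>m. c (m(j := m0 j)))"
  have "\<exists>x. (\<forall>i\<in>I. x i \<in> X i) \<and> (\<Sum>m\<in>S'. c' m * (\<Prod>i\<in>I. x i ^ m i)) \<noteq> 0"
  proof (rule insert.IH)
    show "finite S'" using insert.prems by (simp add: S'_def)
    show "m0(j := 0) \<in> S'" "c' (m0(j := 0)) \<noteq> 0"
      using insert.prems by (auto simp: S'_def c'_def)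
    show "m i = 0" if "m \<in> S'" "i \<notin> I" for m i
      using that insert.prems(2) by (auto simp: S'_def)
    show "infinite (X i)" if "i \<in> I" for i using insert.prems(5) that by simp
  qed
  then obtain x where x: "\<forall>i\<in>I. x i \<in> X i" "(\<Sum>m\<in>S'. c' m * (\<Prod>i\<in>I. x i ^ m i)) \<noteq> 0" by blast
  define p where "p = (\<Sum>m\<in>S. monom (c m * (\<Prod>i\<in>I. x i ^ m i)) (m j))"
  have "coeff p (m0 j) = (\<Sum>m\<in>{m\<in>S. m j = m0 j}. c m * (\<Prod>i\<in>I. x i ^ m i))"
    unfolding p_def coeff_sum coeff_monom
    using insert.prems(1) by (intro sum.mono_neutral_cong_right) auto
  also have "\<dots> = (\<Sum>m\<in>S'. c' m * (\<Prod>i\<in>I. x i ^ m i))"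
    unfolding S'_def
  proof (subst sum.reindex)
    show "inj_on (\<lambda>m. m(j := 0)) {m \<in> S. m j = m0 j}"
      by (auto intro!: inj_onI) (metis fun_upd_triv fun_upd_upd)
    show "(\<Sum>m\<in>{m \<in> S. m j = m0 j}. c m * (\<Prod>i\<in>I. x i ^ m i))
        = sum ((\<lambda>m. c' m * (\<Prod>i\<in>I. x i ^ m i)) \<circ> (\<lambda>m. m(j := 0))) {m \<in> S. m j = m0 j}"
    proof (rule sum.cong)
      fix m assume m: "m \<in> {m \<in> S. m j = m0 j}"
      then have "(m(j := 0))(j := m0 j) = m" by auto
      moreover have "(\<Prod>i\<in>I. x i ^ (m(j := 0)) i) = (\<Prod>i\<in>I. x i ^ m i)"
        using insert.hyps by (intro prod.cong) auto
      ultimately show "c m * (\<Prod>i\<in>I. x i ^ m i) = ((\<lambda>m. c' m * (\<Prod>i\<in>I. x i ^ m i)) \<circ> (\<lambda>m. m(j := 0))) m"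
        unfolding c'_def o_def by metis
    qed simp
  qed
  finally have "p \<noteq> 0" using x(2) by auto
  then have "finite {y. poly p y = 0}" by (rule poly_roots_finite)
  then have "infinite (X j - {y. poly p y = 0})" using insert.prems(5) by (simp add: Diff_infinite_finite)
  then have "X j - {y. poly p y = 0} \<noteq> {}" by (rule infinite_imp_nonempty)
  then obtain y where y: "y \<in> X j" "poly p y \<noteq> 0" by blast
  have "poly p y = (\<Sum>m\<in>S. c m * (\<Prod>i\<in>insert j I. (x(j := y)) i ^ m i))"
    unfolding p_def poly_sum poly_monom
  proof (rule sum.cong)
    fix m assume "m \<in> S"
    have "(\<Prod>i\<in>I. (x(j := y)) i ^ m i) = (\<Prod>i\<in>I. x i ^ m i)"
      using insert.hyps by (intro prod.cong) auto
    then show "c m * (\<Prod>i\<in>I. x i ^ m i) * y ^ m j = c m * (\<Prod>i\<in>insert j I. (x(j := y)) i ^ m i)"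
      using insert.hyps by (simp add: mult_ac)
  qed simp
  with x(1) y show ?case
    using insert.hyps by (intro exI[of _ "x(j := y)"]) auto
qed

lemma mpoly_nonzero_on_grid:
  fixes Q :: "('i::finite, 'a::idom) mpolynomial"
  assumes "Q \<noteq> 0" "\<And>i. infinite (X i)"
  shows "\<exists>x. (\<forall>i. x i \<in> X i) \<and> mpoly_eval Q x \<noteq> 0"
proof -
  define c where "c = (\<lambda>g. Poly_Mapping.lookup Q (Abs_poly_mapping g))"
  from \<open>Q \<noteq> 0\<close> obtain m0 where m0: "m0 \<in> Poly_Mapping.keys Q" by (metis keys_eq_empty ex_in_conv)
  have "\<exists>x. (\<forall>i\<in>UNIV. x i \<in> X i) \<and>
      (\<Sum>m\<in>Poly_Mapping.lookup ` Poly_Mapping.keys Q. c m * (\<Prod>i\<in>UNIV. x i ^ m i)) \<noteq> 0"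
    by (rule polynomial_function_nonzero_on_grid[where ?m0.0 = "Poly_Mapping.lookup m0"])
       (use assms(2) m0 in \<open>auto simp: c_def lookup_inverse in_keys_iff\<close>)
  moreover have "(\<Sum>m\<in>Poly_Mapping.lookup ` Poly_Mapping.keys Q. c m * (\<Prod>i\<in>UNIV. x i ^ m i)) = mpoly_eval Q x" for x
    unfolding mpoly_eval_def
    by (subst sum.reindex) (auto simp: c_def lookup_inverse inj_on_def lookup_inject)
  ultimately show ?thesis by auto
qed

text \<open>
  For fixed \<open>z\<close> a polynomial in the coordinates of \<open>z\<close> and the conjugates of those of \<open>w\<close> is a polynomial
  in the latter.
\<close>

lemma mpoly_eval_slice:
  fixes Q :: "('n::finite + 'n, complex) mpolynomial"
  shows "\<exists>E b. finite E \<and>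
    (\<forall>w. mpoly_eval Q (case_sum (\<lambda>j. z $ j) (\<lambda>j. cnj (w $ j))) = (\<Sum>\<beta>\<in>E. b \<beta> * cnj (vec_monom \<beta> w)))"
proof -
  define r where "r = (\<lambda>m :: 'n + 'n \<Rightarrow>\<^sub>0 nat. \<lambda>j. Poly_Mapping.lookup m (Inr j))"
  define a where "a = (\<lambda>m. Poly_Mapping.lookup Q m * (\<Prod>j\<in>UNIV. z $ j ^ Poly_Mapping.lookup m (Inl j)))"
  define b where "b = (\<lambda>\<beta>. \<Sum>m | m \<in> Poly_Mapping.keys Q \<and> r m = \<beta>. a m)"
  have "mpoly_eval Q (case_sum (\<lambda>j. z $ j) (\<lambda>j. cnj (w $ j)))
      = (\<Sum>\<beta>\<in>r ` Poly_Mapping.keys Q. b \<beta> * cnj (vec_monom \<beta> w))" for w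
  proof -
    have split: "(\<Prod>i\<in>UNIV. case_sum (\<lambda>j. z $ j) (\<lambda>j. cnj (w $ j)) i ^ Poly_Mapping.lookup m i)
        = (\<Prod>j\<in>UNIV. z $ j ^ Poly_Mapping.lookup m (Inl j)) * cnj (vec_monom (r m) w)" for m
      unfolding UNIV_Plus_UNIV[symmetric]
      by (subst prod.Plus) (simp_all add: vec_monom_def r_def)
    have "mpoly_eval Q (case_sum (\<lambda>j. z $ j) (\<lambda>j. cnj (w $ j)))
        = (\<Sum>m\<in>Poly_Mapping.keys Q. a m * cnj (vec_monom (r m) w))"
      unfolding mpoly_eval_def split a_def by (simp add: mult.assoc)
    also have "\<dots> = (\<Sum>\<beta>\<in>r ` Poly_Mapping.keys Q. \<Sum>m | m \<in> Poly_Mapping.keys Q \<and> r m = \<beta>. a m * cnj (vec_monom (r m) w))"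
      by (rule sum.image_gen) simp
    also have "\<dots> = (\<Sum>\<beta>\<in>r ` Poly_Mapping.keys Q. b \<beta> * cnj (vec_monom \<beta> w))"
      unfolding b_def sum_distrib_right by (intro sum.cong) auto
    finally show ?thesis .
  qed
  then show ?thesis by (intro exI[of _ "r ` Poly_Mapping.keys Q"] exI[of _ b]) simp
qed

lemma conjugate_polynomial_nonzero_on_open:
  fixes b :: "('n::finite \<Rightarrow> nat) \<Rightarrow> complex"
  assumes "open V" "v \<in> V" "finite E" "\<beta>0 \<in> E" "b \<beta>0 \<noteq> 0"
  shows "\<exists>w\<in>V. (\<Sum>\<beta>\<in>E. b \<beta> * cnj (vec_monom \<beta> w)) \<noteq> 0"
proof -
  from assms(1,2) obtain A where A: "\<And>i. open (A i)" "\<And>i. v $ i \<in> A i" "\<And>y. (\<And>i. y $ i \<in> A i) \<Longrightarrow> y \<in> V"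
    unfolding open_vec_def by metis
  have "infinite (A i)" for i using A(1)[of i] A(2)[of i] finite_imp_not_open by blast
  then have "infinite (cnj ` A i)" for i
    by (subst finite_image_iff) (auto simp: inj_on_def)
  then have "\<exists>x. (\<forall>i\<in>UNIV. x i \<in> cnj ` A i) \<and> (\<Sum>\<beta>\<in>E. b \<beta> * (\<Prod>i\<in>UNIV. x i ^ \<beta> i)) \<noteq> 0"
    using assms by (intro polynomial_function_nonzero_on_grid[where ?m0.0 = \<beta>0]) auto
  then obtain x where x: "\<And>i. x i \<in> cnj ` A i" "(\<Sum>\<beta>\<in>E. b \<beta> * (\<Prod>i\<in>UNIV. x i ^ \<beta> i)) \<noteq> 0" by auto
  define w where "w = (\<chi> i. cnj (x i))"
  have "w $ i \<in> A i" for i using x(1)[of i] by (auto simp: w_def)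
  then have "w \<in> V" by (rule A(3))
  moreover have "cnj (vec_monom \<beta> w) = (\<Prod>i\<in>UNIV. x i ^ \<beta> i)" for \<beta>
    by (simp add: vec_monom_def w_def)
  ultimately show ?thesis using x(2) by (intro bexI[of _ w]) simp_all
qed

section \<open>Independence of the shifts of a rational function\<close>

text \<open>
  Finitely many shifts of the rational function \<open>x\<^sup>m / \<Psi>(x)\<close> are linearly independent, even on large
  natural numbers. Let \<open>i\<^sub>0\<close> be the largest index with a nonzero coefficient and \<open>\<omega>\<close> a root of \<open>\<Psi>\<close> with the
  largest real part. After clearing denominators the relation is an identity of polynomials, and at
  \<open>x = i\<^sub>0 + \<omega>\<close> all of its terms vanish except the one with index \<open>i\<^sub>0\<close>.
\<close>

lemma no_shift_relation:
  fixes b :: "nat \<Rightarrow> complex" and m :: nat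
  defines "\<Psi> \<equiv> (\<lambda>x::complex. \<Sum>l<m. x ^ l)"
  assumes "m \<ge> 2" "finite A"
    and rel: "\<And>t. t \<ge> T \<Longrightarrow> (\<Sum>i\<in>A. b i * (of_nat t - of_nat i) ^ m / \<Psi> (of_nat t - of_nat i)) = 0"
    and "i \<in> A"
  shows "b i = 0"
proof (rule ccontr)
  assume "b i \<noteq> 0"
  define B where "B = {i\<in>A. b i \<noteq> 0}"
  have B: "finite B" "B \<noteq> {}" using \<open>finite A\<close> \<open>i \<in> A\<close> \<open>b i \<noteq> 0\<close> by (auto simp: B_def)
  define i0 where "i0 = Max B"
  have i0: "i0 \<in> B" "\<And>i. i \<in> B \<Longrightarrow> i \<le> i0" using B by (auto simp: i0_def)
  define q where "q = (\<Sum>l<m. monom (1::complex) l)"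
  have q: "poly q x = \<Psi> x" for x by (simp add: q_def \<Psi>_def poly_sum poly_monom)
  have cq: "coeff q l = (if l < m then 1 else 0)" for l
    by (simp add: q_def coeff_sum)
  have "q \<noteq> 0" using cq[of 0] \<open>m \<ge> 2\<close> by auto
  have "coeff q 1 = 1" using \<open>m \<ge> 2\<close> by (simp add: cq)
  then obtain x0 where "poly q x0 = 0"
    using fundamental_theorem_of_algebra_alt[of q] by fastforce
  define Z where "Z = {x. poly q x = 0}"
  have Z: "finite Z" "Z \<noteq> {}"
    using poly_roots_finite[OF \<open>q \<noteq> 0\<close>] \<open>poly q x0 = 0\<close> by (auto simp: Z_def)
  have "Max (Re ` Z) \<in> Re ` Z" using Z by (intro Max_in) auto
  then obtain w where w: "w \<in> Z" "Re w = Max (Re ` Z)" by auto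
  have wmax: "Re y \<le> Re w" if "y \<in> Z" for y
    using Z that by (simp add: w)
  have \<Psi>w: "\<Psi> w = 0" using w by (simp add: Z_def q)
  have \<Psi>0: "\<Psi> 0 = 1"
    using \<open>m \<ge> 2\<close> q[of 0] by (simp add: poly_0_coeff_0 cq)
  then have "w \<noteq> 0" using \<Psi>w by auto
  have \<Psi>shift: "\<Psi> (w + of_nat j) \<noteq> 0" if "j > 0" for j
    using wmax[of "w + of_nat j"] that by (auto simp: Z_def q)
  \<comment> \<open>the relation with denominators cleared\<close>
  define P where "P = (\<Sum>i\<in>B. smult (b i) ([:- of_nat i, 1:] ^ m * (\<Prod>i'\<in>B-{i}. pcompose q [:- of_nat i', 1:])))"
  have P: "poly P x = (\<Sum>i\<in>B. b i * (x - of_nat i) ^ m * (\<Prod>i'\<in>B-{i}. \<Psi> (x - of_nat i')))" for x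
    by (simp add: P_def poly_sum poly_prod poly_pcompose q mult.assoc)
  have "poly P (of_nat t) = 0" if "t \<ge> max T (Suc i0)" for t
  proof -
    have nz: "\<Psi> (of_nat t - of_nat i) \<noteq> 0" if "i \<in> B" for i
    proof -
      have "i < t" using i0(2)[OF that] \<open>t \<ge> max T (Suc i0)\<close> by simp
      then have "\<Psi> (of_nat t - of_nat i) = of_nat (\<Sum>l<m. (t - i) ^ l)"
        by (simp add: \<Psi>_def of_nat_diff)
      moreover have "(\<Sum>l<m. (t - i) ^ l) > 0"
        using \<open>m \<ge> 2\<close> \<open>i < t\<close> by (intro sum_pos) (auto simp: lessThan_empty_iff)
      ultimately show ?thesis by (metis of_nat_eq_0_iff less_irrefl)
    qed
    have "poly P (of_nat t) = (\<Sum>i\<in>B. b i * (of_nat t - of_nat i) ^ m / \<Psi> (of_nat t - of_nat i)) * (\<Prod>i\<in>B. \<Psi> (of_nat t - of_nat i))"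
      unfolding P sum_distrib_right
    proof (rule sum.cong)
      fix i assume "i \<in> B"
      then show "b i * (of_nat t - of_nat i) ^ m * (\<Prod>i'\<in>B - {i}. \<Psi> (of_nat t - of_nat i'))
         = b i * (of_nat t - of_nat i) ^ m / \<Psi> (of_nat t - of_nat i) * (\<Prod>i\<in>B. \<Psi> (of_nat t - of_nat i))"
        using nz B by (simp add: prod.remove[of B i])
    qed simp
    also have "(\<Sum>i\<in>B. b i * (of_nat t - of_nat i) ^ m / \<Psi> (of_nat t - of_nat i))
        = (\<Sum>i\<in>A. b i * (of_nat t - of_nat i) ^ m / \<Psi> (of_nat t - of_nat i))"
      using \<open>finite A\<close> by (intro sum.mono_neutral_left) (auto simp: B_def)
    also have "\<dots> = 0" using rel that by simp
    finally show ?thesis by simp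
  qed
  then have "of_nat ` {max T (Suc i0)..} \<subseteq> {x. poly P x = 0}" by auto
  moreover have "infinite (of_nat ` {max T (Suc i0)..} :: complex set)"
    by (subst finite_image_iff) (auto simp: inj_on_def infinite_Ici)
  ultimately have "P = 0" using poly_roots_finite finite_subset by blast
  then have "0 = poly P (of_nat i0 + w)" by simp
  also have "\<dots> = b i0 * w ^ m * (\<Prod>i'\<in>B-{i0}. \<Psi> (w + of_nat (i0 - i')))"
  proof -
    have "(\<Sum>i\<in>B - {i0}. b i * (of_nat i0 + w - of_nat i) ^ m * (\<Prod>i'\<in>B-{i}. \<Psi> (of_nat i0 + w - of_nat i'))) = 0"
    proof (rule sum.neutral, rule ballI)
      fix i assume "i \<in> B - {i0}"
      then have "(\<Prod>i'\<in>B-{i}. \<Psi> (of_nat i0 + w - of_nat i')) = 0"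
        using B i0 \<Psi>w by (intro prod_zero bexI[of _ i0]) auto
      then show "b i * (of_nat i0 + w - of_nat i) ^ m * (\<Prod>i'\<in>B-{i}. \<Psi> (of_nat i0 + w - of_nat i')) = 0" by simp
    qed
    moreover have "(\<Prod>i'\<in>B-{i0}. \<Psi> (of_nat i0 + w - of_nat i')) = (\<Prod>i'\<in>B-{i0}. \<Psi> (w + of_nat (i0 - i')))"
      using i0 by (intro prod.cong refl arg_cong[of _ _ \<Psi>]) (auto simp: of_nat_diff)
    ultimately show ?thesis
      unfolding P using B i0 by (simp add: sum.remove[of B i0])
  qed
  finally have "(\<Prod>i'\<in>B-{i0}. \<Psi> (w + of_nat (i0 - i'))) = 0"
    using i0 \<open>w \<noteq> 0\<close> by (simp add: B_def)
  then obtain i' where "i' \<in> B - {i0}" "\<Psi> (w + of_nat (i0 - i')) = 0"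
    using B by (auto simp: prod_zero_iff)
  then show False using \<Psi>shift[of "i0 - i'"] i0(2)[of i'] by auto
qed

section \<open>Non-rationality of the Bergman kernel\<close>

lemma set_integral_linear_combination:
  fixes c :: "'b \<Rightarrow> 'c::{real_normed_field, banach, second_countable_topology}"
  assumes "\<And>i. i \<in> E \<Longrightarrow> set_integrable M S (g i)"
  shows "(LINT w:S|M. (\<Sum>i\<in>E. c i * g i w)) = (\<Sum>i\<in>E. c i * (LINT w:S|M. g i w))"
proof -
  have "(LINT w:S|M. (\<Sum>i\<in>E. c i * g i w)) = (\<integral>w. (\<Sum>i\<in>E. c i * (indicator S w *\<^sub>R g i w)) \<partial>M)"
    by (simp add: set_lebesgue_integral_def scaleR_sum_right)
  also have "\<dots> = (\<Sum>i\<in>E. \<integral>w. c i * (indicator S w *\<^sub>R g i w) \<partial>M)"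
    using assms by (intro Bochner_Integration.integral_sum integrable_mult_right) (simp add: set_integrable_def)
  also have "\<dots> = (\<Sum>i\<in>E. c i * (LINT w:S|M. g i w))"
    by (simp only: integral_mult_right_zero set_lebesgue_integral_def)
  finally show ?thesis .
qed

text \<open>
  A nonzero polynomial times \<open>f\<close> is never a polynomial, provided that \<open>f\<close> has the inner products of a
  kernel function with the powers of \<open>w\<^sub>k\<close>; there \<open>\<zeta>\<close> is the conjugate of \<open>z\<^sub>k\<close>.
\<close>

lemma no_polynomial_relation:
  fixes k :: "'n::finite" and b p :: "('n \<Rightarrow> nat) \<Rightarrow> complex"
  assumes n: "CARD('n) \<ge> 3"
    and f: "f \<in> bergman_space (hartogs_domain k)"
    and "\<zeta> \<noteq> 0" and repr: "\<And>d. (LINT w:hartogs_domain k|lborel. f w * cnj (w $ k ^ d)) = \<zeta> ^ d"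
    and fin: "finite E" "finite E'"
    and rel: "\<And>w. w \<in> hartogs_domain k \<Longrightarrow>
      f w * (\<Sum>\<beta>\<in>E. b \<beta> * vec_monom \<beta> w) = (\<Sum>\<beta>\<in>E'. p \<beta> * vec_monom \<beta> w)"
    and "\<beta>1 \<in> E"
  shows "b \<beta>1 = 0"
proof (rule ccontr)
  assume "b \<beta>1 \<noteq> 0"
  let ?H = "hartogs_domain k"
  define m where "m = CARD('n) - 1"
  have n2: "CARD('n) \<ge> 2" and m2: "m \<ge> 2" using n by (auto simp: m_def)
  define I where "I = (\<lambda>\<beta> \<gamma>. LINT w:?H|lborel. f w * (vec_monom \<beta> w * cnj (vec_monom \<gamma> w)))"
  define N where "N = (\<lambda>\<gamma>. LINT w:?H|lborel. vec_monom \<gamma> w * cnj (vec_monom \<gamma> w))"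
  obtain C where C: "\<And>\<beta> \<gamma>. (\<And>j. j \<noteq> k \<Longrightarrow> \<beta> j = \<gamma> j) \<Longrightarrow> \<beta> k \<le> \<gamma> k \<Longrightarrow> I \<beta> \<gamma> = C (\<gamma> k - \<beta> k) * N \<gamma>"
    using integral_bergman_times_monoms[OF f n2] unfolding I_def N_def by blast
  define \<Psi> where "\<Psi> = (\<lambda>x::complex. \<Sum>l<m. x ^ l)"
  have Cval: "C d = \<zeta> ^ d * of_nat (d + 2) ^ m / (of_real (pi ^ CARD('n)) * \<Psi> (of_nat (d + 2)))" for d
  proof -
    define e where "e = (\<lambda>i. if i = k then d else 0)"
    have e: "vec_monom e w = w $ k ^ d" for w
      unfolding e_def by (rule vec_monom_single)
    \<comment> \<open>compare \<open>repr\<close> with the integral formula for \<open>\<beta> = 0\<close> and the exponents of \<open>w\<^sub>k\<^sup>d\<close>\<close>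
    have "vec_monom (\<lambda>_. 0) w = 1" for w :: "complex ^ 'n" by (simp add: vec_monom_def)
    then have "C d * N e = \<zeta> ^ d"
      using C[of "\<lambda>_. 0" e] repr[of d] by (simp add: e_def[symmetric] I_def e) (simp add: e_def)
    moreover have "N e * of_nat (d + 2) ^ m = of_real (pi ^ CARD('n)) * \<Psi> (of_nat (d + 2))"
      unfolding N_def e m_def \<Psi>_def by (rule integral_coordinate_power[OF n2])
    moreover have "N e \<noteq> 0" unfolding N_def by (rule integral_vec_monom_square_nonzero[OF n2])
    moreover have "(of_nat (d + 2) :: complex) ^ m \<noteq> 0"
      by (intro power_not_zero) (simp only: of_nat_eq_0_iff)
    ultimately have "\<zeta> ^ d * of_nat (d + 2) ^ m = C d * (of_real (pi ^ CARD('n)) * \<Psi> (of_nat (d + 2)))"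
      "of_real (pi ^ CARD('n)) * \<Psi> (of_nat (d + 2)) \<noteq> 0"
      by (metis mult.assoc, metis mult_eq_0_iff)
    then show ?thesis by (metis nonzero_mult_div_cancel_right)
  qed
  have lin: "(\<Sum>\<beta>\<in>E. b \<beta> * I \<beta> \<gamma>) = 0" if "\<And>\<beta>. \<beta> \<in> E' \<Longrightarrow> \<beta> k < \<gamma> k" for \<gamma>
  proof -
    have "(LINT w:?H|lborel. (\<Sum>\<beta>\<in>E. b \<beta> * (f w * (vec_monom \<beta> w * cnj (vec_monom \<gamma> w)))))
        = (LINT w:?H|lborel. (\<Sum>\<beta>\<in>E'. p \<beta> * (vec_monom \<beta> w * cnj (vec_monom \<gamma> w))))"
    proof (rule set_lebesgue_integral_cong)
      show "\<forall>w. w \<in> ?H \<longrightarrow> (\<Sum>\<beta>\<in>E. b \<beta> * (f w * (vec_monom \<beta> w * cnj (vec_monom \<gamma> w))))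
          = (\<Sum>\<beta>\<in>E'. p \<beta> * (vec_monom \<beta> w * cnj (vec_monom \<gamma> w)))"
      proof (intro allI impI)
        fix w assume "w \<in> ?H"
        have "(\<Sum>\<beta>\<in>E. b \<beta> * (f w * (vec_monom \<beta> w * cnj (vec_monom \<gamma> w))))
            = (f w * (\<Sum>\<beta>\<in>E. b \<beta> * vec_monom \<beta> w)) * cnj (vec_monom \<gamma> w)"
          by (simp add: sum_distrib_left sum_distrib_right mult_ac)
        also have "\<dots> = (\<Sum>\<beta>\<in>E'. p \<beta> * (vec_monom \<beta> w * cnj (vec_monom \<gamma> w)))"
          unfolding rel[OF \<open>w \<in> ?H\<close>] by (simp add: sum_distrib_left sum_distrib_right mult_ac)
        finally show "(\<Sum>\<beta>\<in>E. b \<beta> * (f w * (vec_monom \<beta> w * cnj (vec_monom \<gamma> w))))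
            = (\<Sum>\<beta>\<in>E'. p \<beta> * (vec_monom \<beta> w * cnj (vec_monom \<gamma> w)))" .
      qed
    qed (simp add: borel_open open_hartogs_domain)
    also have "\<dots> = (\<Sum>\<beta>\<in>E'. p \<beta> * (LINT w:?H|lborel. vec_monom \<beta> w * cnj (vec_monom \<gamma> w)))"
      by (intro set_integral_linear_combination set_integrable_monoms)
    also have "\<dots> = 0" using that by (intro sum.neutral) (simp add: integral_monoms_orthogonal)
    also have "(LINT w:?H|lborel. (\<Sum>\<beta>\<in>E. b \<beta> * (f w * (vec_monom \<beta> w * cnj (vec_monom \<gamma> w)))))
        = (\<Sum>\<beta>\<in>E. b \<beta> * I \<beta> \<gamma>)"
      unfolding I_def by (intro set_integral_linear_combination set_integrable_bergman_times_monoms f)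
    finally show ?thesis .
  qed
  define E0 where "E0 = {\<beta>\<in>E. b \<beta> \<noteq> 0}"
  \<comment> \<open>the total degree in the coordinates other than \<open>w\<^sub>k\<close>\<close>
  define s where "s = (\<lambda>\<beta>::'n \<Rightarrow> nat. \<Sum>j\<in>-{k}. \<beta> j)"
  have E0: "finite E0" "E0 \<noteq> {}" using fin \<open>\<beta>1 \<in> E\<close> \<open>b \<beta>1 \<noteq> 0\<close> by (auto simp: E0_def)
  then have "Min (s ` E0) \<in> s ` E0" by (intro Min_in) auto
  then obtain \<beta>0 where \<beta>0: "\<beta>0 \<in> E0" "s \<beta>0 = Min (s ` E0)" by auto
  have smin: "s \<beta>0 \<le> s \<beta>" if "\<beta> \<in> E0" for \<beta> using E0 that by (simp add: \<beta>0)
  \<comment> \<open>the exponents of \<open>w\<^sub>k\<close> in the terms that agree with \<open>\<beta>0\<close> off \<open>k\<close>\<close>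
  define A where "A = {i. \<beta>0(k := i) \<in> E0}"
  have inj: "inj (\<lambda>i. \<beta>0(k := i))" by (rule injI) (metis fun_upd_same)
  have A: "finite A" "\<beta>0 k \<in> A"
    using finite_vimageI[OF E0(1) inj] \<beta>0 by (auto simp: A_def vimage_def)
  define T where "T = Max (insert 0 ((\<lambda>\<beta>. Suc (\<beta> k)) ` E' \<union> A))"
  define b' where "b' = (\<lambda>i. b (\<beta>0(k := i)) / \<zeta> ^ i)"
  have "b' (\<beta>0 k) = 0"
  \<comment> \<open>the argument of \<open>\<Psi>\<close> in \<open>Cval\<close> is \<open>d + 2\<close>, whence the offset between \<open>t\<close> and \<open>t'\<close>\<close>
  proof (rule no_shift_relation[OF m2 A(1) _ A(2)])
    fix t' assume t': "t' \<ge> T + 2"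
    define t where "t = t' - 2"
    have t: "t \<ge> T" "t' = t + 2" using t' by (auto simp: t_def)
    have TE: "\<beta> k < t" if "\<beta> \<in> E'" for \<beta>
    proof -
      have "Suc (\<beta> k) \<le> T" unfolding T_def using fin A that by (intro Max_ge) auto
      then show ?thesis using t by simp
    qed
    have TA: "i \<le> t" if "i \<in> A" for i
    proof -
      have "i \<le> T" unfolding T_def using fin A that by (intro Max_ge) auto
      then show ?thesis using t by simp
    qed
    define \<gamma> where "\<gamma> = \<beta>0(k := t)"
    \<comment> \<open>by minimality of \<open>s \<beta>0\<close>, every other exponent exceeds \<open>\<gamma>\<close> in some coordinate other than \<open>k\<close>\<close>
    have vanish: "b \<beta> * I \<beta> \<gamma> = 0" if "\<beta> \<in> E - (\<lambda>i. \<beta>0(k := i)) ` A" for \<beta>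
    proof (cases "\<beta> \<in> E0")
      case False then show ?thesis using that by (auto simp: E0_def)
    next
      case True
      have "\<exists>j. j \<noteq> k \<and> \<beta>0 j < \<beta> j"
      proof (rule ccontr)
        assume "\<not> ?thesis"
        then have le: "\<And>j. j \<noteq> k \<Longrightarrow> \<beta> j \<le> \<beta>0 j" by (meson not_less)
        have "\<beta> j = \<beta>0 j" if "j \<noteq> k" for j
        proof (rule ccontr)
          assume "\<beta> j \<noteq> \<beta>0 j"
          with le[OF that] have "\<beta> j < \<beta>0 j" by simp
          then have "s \<beta> < s \<beta>0" unfolding s_def
            using le that by (intro sum_strict_mono_ex1) auto
          with smin[OF True] show False by simp
        qed
        then have "\<beta> = \<beta>0(k := \<beta> k)" by auto
        with True that show False by (auto simp: A_def)
      qed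
      then obtain j where "j \<noteq> k" "\<gamma> j < \<beta> j" by (auto simp: \<gamma>_def)
      then show ?thesis unfolding I_def by (simp add: integral_bergman_times_monoms_eq_0[OF f])
    qed
    have "0 = (\<Sum>\<beta>\<in>E. b \<beta> * I \<beta> \<gamma>)"
      by (rule lin[symmetric]) (simp add: \<gamma>_def TE)
    also have "\<dots> = (\<Sum>\<beta>\<in>(\<lambda>i. \<beta>0(k := i)) ` A. b \<beta> * I \<beta> \<gamma>)"
      using vanish fin by (intro sum.mono_neutral_right) (auto simp: A_def E0_def)
    also have "\<dots> = (\<Sum>i\<in>A. b (\<beta>0(k := i)) * I (\<beta>0(k := i)) \<gamma>)"
      by (subst sum.reindex[OF inj_on_subset[OF inj subset_UNIV]]) simp
    also have "\<dots> = (\<Sum>i\<in>A. b (\<beta>0(k := i)) * (C (t - i) * N \<gamma>))"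
    proof (rule sum.cong)
      fix i assume "i \<in> A"
      then have "I (\<beta>0(k := i)) \<gamma> = C (t - i) * N \<gamma>"
        using C[of "\<beta>0(k := i)" \<gamma>] TA[of i] by (simp add: \<gamma>_def)
      then show "b (\<beta>0(k := i)) * I (\<beta>0(k := i)) \<gamma> = b (\<beta>0(k := i)) * (C (t - i) * N \<gamma>)" by simp
    qed simp
    also have "\<dots> = (\<Sum>i\<in>A. (N \<gamma> * \<zeta> ^ t / of_real (pi ^ CARD('n)))
        * (b' i * (of_nat t' - of_nat i) ^ m / \<Psi> (of_nat t' - of_nat i)))"
    proof (rule sum.cong)
      fix i assume "i \<in> A"
      have x: "of_nat (t - i + 2) = (of_nat t' - of_nat i :: complex)"
        using TA[OF \<open>i \<in> A\<close>] by (simp add: t of_nat_diff)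
      have \<zeta>: "\<zeta> ^ (t - i) = \<zeta> ^ t / \<zeta> ^ i"
        using TA[OF \<open>i \<in> A\<close>] \<open>\<zeta> \<noteq> 0\<close> by (simp add: power_diff)
      show "b (\<beta>0(k := i)) * (C (t - i) * N \<gamma>)
          = (N \<gamma> * \<zeta> ^ t / of_real (pi ^ CARD('n))) * (b' i * (of_nat t' - of_nat i) ^ m / \<Psi> (of_nat t' - of_nat i))"
        unfolding Cval x \<zeta> b'_def by (simp add: mult_ac)
    qed simp
    also have "\<dots> = (N \<gamma> * \<zeta> ^ t / of_real (pi ^ CARD('n)))
        * (\<Sum>i\<in>A. b' i * (of_nat t' - of_nat i) ^ m / \<Psi> (of_nat t' - of_nat i))"
      by (simp add: sum_distrib_left)
    finally have "(N \<gamma> * \<zeta> ^ t / of_real (pi ^ CARD('n)))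
        * (\<Sum>i\<in>A. b' i * (of_nat t' - of_nat i) ^ m / \<Psi> (of_nat t' - of_nat i)) = 0" by simp
    moreover have "N \<gamma> \<noteq> 0" unfolding N_def by (rule integral_vec_monom_square_nonzero[OF n2])
    ultimately show "(\<Sum>i\<in>A. b' i * (of_nat t' - of_nat i) ^ m / (\<Sum>l<m. (of_nat t' - of_nat i) ^ l)) = 0"
      using \<open>\<zeta> \<noteq> 0\<close> unfolding \<Psi>_def by simp
  qed
  then have "b \<beta>0 = 0" using \<open>\<zeta> \<noteq> 0\<close> by (simp add: b'_def)
  with \<beta>0 show False by (simp add: E0_def)
qed

lemma coordinate_power_in_bergman_space:
  "(\<lambda>w. w $ k ^ d) \<in> bergman_space (hartogs_domain k)"
proof -
  have "\<exists>D. ((\<lambda>w. w $ k ^ d) has_derivative D) (at z) \<and> (\<forall>c v. D (c *s v) = c * D v)" for z :: "complex ^ 'a"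
  proof (intro exI conjI allI)
    show "((\<lambda>w. w $ k ^ d) has_derivative (\<lambda>v. of_nat d * v $ k * z $ k ^ (d - 1))) (at z)"
      by (rule has_derivative_power) (rule bounded_linear_imp_has_derivative[OF bounded_linear_vec_nth])
  qed (simp add: mult_ac)
  then have "(\<lambda>w. w $ k ^ d) mholomorphic_on hartogs_domain k" by (simp add: mholomorphic_on_def)
  moreover have "set_integrable lborel (hartogs_domain k) (\<lambda>w. (cmod (w $ k ^ d))\<^sup>2)"
  proof -
    define e where "e = (\<lambda>i. if i = k then d else 0)"
    have e: "vec_monom e w = w $ k ^ d" for w
      unfolding e_def by (rule vec_monom_single)
    from integrable_norm[OF set_integrable_monoms[of k e e, unfolded set_integrable_def]]
    show ?thesis unfolding set_integrable_def
      by (simp add: e norm_mult norm_power power2_eq_square)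
  qed
  ultimately show ?thesis by (simp add: bergman_space_def)
qed

text \<open>
  The domain contains a product of nonempty open sets, so that nonzero polynomials do not vanish
  identically on it.
\<close>

lemma hartogs_domain_contains_grid:
  assumes "CARD('n::finite) \<ge> 2"
    and "\<And>j. v $ j \<in> (if j = k then {a. 1/2 < cmod a \<and> cmod a < 1} else {a. cmod a < 1/2})"
  shows "v \<in> hartogs_domain (k::'n)"
proof -
  have lt: "cmod (v $ j) < 1/2" if "j \<noteq> k" for j using assms(2)[of j] that by simp
  have k: "1/2 < cmod (v $ k)" "cmod (v $ k) < 1" using assms(2)[of k] by auto
  from other_coordinates_nonempty[OF assms(1), of k] obtain j where j: "j \<in> -{k}" by blast
  have "(\<Prod>i\<in>-{k}. cmod (v $ i)) = cmod (v $ j) * (\<Prod>i\<in>-{k}-{j}. cmod (v $ i))"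
    using j by (subst prod.remove[of _ j]) auto
  also have "\<dots> \<le> cmod (v $ j) * 1"
  proof (intro mult_left_mono prod_le_1 conjI)
    fix i assume "i \<in> -{k}-{j}"
    then show "cmod (v $ i) \<le> 1" using lt[of i] by simp
  qed simp_all
  also have "\<dots> < cmod (v $ k)" using lt[of j] j k by simp
  finally have "(\<Prod>i\<in>-{k}. cmod (v $ i)) < cmod (v $ k)" .
  moreover have "cmod (v $ i) < 1" for i using lt[of i] k by (cases "i = k") auto
  ultimately show ?thesis by (simp add: hartogs_domain_def polydisc_def prod_norm[symmetric])
qed

theorem theorem1p2:
  fixes k :: "'n::finite"
    and K :: "complex ^ 'n \<Rightarrow> complex ^ 'n \<Rightarrow> complex"
  assumes "CARD('n) \<ge> 3"
    and "is_bergman_kernel (hartogs_domain k) K"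
  shows "\<not> rational_kernel_on (hartogs_domain k) K"
proof
  let ?H = "hartogs_domain k"
  assume "rational_kernel_on ?H K"
  then obtain P Q :: "('n + 'n, complex) mpolynomial" where "Q \<noteq> 0"
    and PQ: "\<And>z w. z \<in> ?H \<Longrightarrow> w \<in> ?H \<Longrightarrow> mpoly_eval Q (case_sum (\<lambda>j. z $ j) (\<lambda>j. cnj (w $ j))) \<noteq> 0 \<Longrightarrow>
      K z w = mpoly_eval P (case_sum (\<lambda>j. z $ j) (\<lambda>j. cnj (w $ j))) / mpoly_eval Q (case_sum (\<lambda>j. z $ j) (\<lambda>j. cnj (w $ j)))"
    unfolding rational_kernel_on_def Let_def by blast
  have n2: "CARD('n) \<ge> 2" using assms(1) by simp
  define Y where "Y = (\<lambda>j. if j = k then {a::complex. 1/2 < cmod a \<and> cmod a < 1} else {a. cmod a < 1/2})"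
  have "infinite (Y j)" for j
  proof -
    have "open (Y j)"
    proof (cases "j = k")
      case True
      have "open ({a::complex. 1/2 < cmod a} \<inter> {a. cmod a < 1})"
        by (intro open_Int open_Collect_less continuous_intros)
      then show ?thesis using True by (simp add: Y_def Collect_conj_eq)
    next
      case False
      have "open {a::complex. cmod a < 1/2}" by (intro open_Collect_less continuous_intros)
      then show ?thesis using False by (simp add: Y_def)
    qed
    moreover have "(if j = k then 3/4 else 1/4) \<in> Y j" by (simp add: Y_def norm_divide)
    ultimately show ?thesis using finite_imp_not_open by blast
  qed
  then have "infinite (case_sum Y Y i)" for i by (cases i) auto
  then obtain x where x: "\<And>i. x i \<in> case_sum Y Y i" "mpoly_eval Q x \<noteq> 0"
    using mpoly_nonzero_on_grid[OF \<open>Q \<noteq> 0\<close>, of "case_sum Y Y"] by blast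
  define z w0 where "z = (\<chi> j. x (Inl j))" and "w0 = (\<chi> j. cnj (x (Inr j)))"
  have z: "z \<in> ?H"
    using x(1)[of "Inl _"] by (intro hartogs_domain_contains_grid[OF n2]) (simp add: z_def Y_def)
  have "z $ k \<in> Y k" using x(1)[of "Inl k"] by (simp add: z_def)
  then have zk: "z $ k \<noteq> 0" by (auto simp: Y_def)
  have xzw: "case_sum (\<lambda>j. z $ j) (\<lambda>j. cnj (w0 $ j)) = x"
    by (auto simp: fun_eq_iff z_def w0_def split: sum.split)
  obtain E b where E: "finite E"
    and b: "\<And>w. mpoly_eval Q (case_sum (\<lambda>j. z $ j) (\<lambda>j. cnj (w $ j))) = (\<Sum>\<beta>\<in>E. b \<beta> * cnj (vec_monom \<beta> w))"
    using mpoly_eval_slice[of Q z] by blast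
  obtain E' p where E': "finite E'"
    and p: "\<And>w. mpoly_eval P (case_sum (\<lambda>j. z $ j) (\<lambda>j. cnj (w $ j))) = (\<Sum>\<beta>\<in>E'. p \<beta> * cnj (vec_monom \<beta> w))"
    using mpoly_eval_slice[of P z] by blast
  have "(\<Sum>\<beta>\<in>E. b \<beta> * cnj (vec_monom \<beta> w0)) \<noteq> 0"
    using x(2) unfolding b[symmetric] xzw .
  then obtain \<beta>1 where \<beta>1: "\<beta>1 \<in> E" "b \<beta>1 \<noteq> 0"
    by (metis (no_types, lifting) mult_zero_left sum.neutral)
  define f where "f = (\<lambda>w. cnj (K z w))"
  have f: "f \<in> bergman_space ?H"
    using assms(2) z by (auto simp: is_bergman_kernel_def f_def)
  define q where "q = (\<lambda>w. \<Sum>\<beta>\<in>E. cnj (b \<beta>) * vec_monom \<beta> w)"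
  define r where "r = (\<lambda>w. \<Sum>\<beta>\<in>E'. cnj (p \<beta>) * vec_monom \<beta> w)"
  have qr: "f w * q w = r w" if "w \<in> ?H" "q w \<noteq> 0" for w
  proof -
    have q: "mpoly_eval Q (case_sum (\<lambda>j. z $ j) (\<lambda>j. cnj (w $ j))) = cnj (q w)" by (simp add: b q_def)
    have r: "mpoly_eval P (case_sum (\<lambda>j. z $ j) (\<lambda>j. cnj (w $ j))) = cnj (r w)" by (simp add: p r_def)
    have "K z w = cnj (r w) / cnj (q w)"
      using PQ[OF z \<open>w \<in> ?H\<close>] that(2) by (simp add: q r)
    then show ?thesis using that(2) by (simp add: f_def)
  qed
  \<comment> \<open>by continuity the relation extends to the zeros of \<open>q\<close>, which have empty interior\<close>
  have rel: "f w * q w = r w" if "w \<in> ?H" for w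
  proof (rule ccontr)
    assume ne: "f w * q w \<noteq> r w"
    define V where "V = {v \<in> ?H. f v * q v - r v \<in> - {0}}"
    have "continuous_on ?H f"
      using f by (intro mholomorphic_on_imp_continuous_on) (simp add: bergman_space_def)
    then have "continuous_on ?H (\<lambda>v. f v * q v - r v)"
      unfolding q_def r_def by (intro continuous_intros continuous_on_vec_monom)
    from continuous_open_preimage[OF this open_hartogs_domain open_Compl[OF closed_singleton[of 0]]]
    have "open V" by (simp add: V_def vimage_def Int_def)
    moreover have "w \<in> V" using that ne by (simp add: V_def)
    ultimately obtain v where v: "v \<in> V" "(\<Sum>\<beta>\<in>E. b \<beta> * cnj (vec_monom \<beta> v)) \<noteq> 0"
      using conjugate_polynomial_nonzero_on_open[of V w E \<beta>1 b] E \<beta>1 by blast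
    have "(\<Sum>\<beta>\<in>E. b \<beta> * cnj (vec_monom \<beta> v)) = cnj (q v)" by (simp add: q_def)
    with v have "q v \<noteq> 0" by auto
    with qr[of v] v show False by (simp add: V_def)
  qed
  have repr: "(LINT w:?H|lborel. f w * cnj (w $ k ^ d)) = cnj (z $ k) ^ d" for d
  proof -
    have "g z = (LINT w:?H|lborel. g w * K z w)" if "g \<in> bergman_space ?H" for g
      using assms(2) that z unfolding is_bergman_kernel_def by blast
    from this[OF coordinate_power_in_bergman_space]
    have "z $ k ^ d = (LINT w:?H|lborel. w $ k ^ d * K z w)" .
    then have "cnj (z $ k ^ d) = cnj (LINT w:?H|lborel. w $ k ^ d * K z w)" by simp
    also have "\<dots> = (LINT w:?H|lborel. f w * cnj (w $ k ^ d))"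
      unfolding set_lebesgue_integral_def f_def
      by (subst Bochner_Integration.integral_cnj [symmetric])
         (auto intro!: Bochner_Integration.integral_cong simp: mult_ac scaleR_conv_of_real)
    finally show ?thesis by simp
  qed
  have "cnj (z $ k) \<noteq> 0" using zk by simp
  from no_polynomial_relation[OF assms(1) f this repr E E' rel[unfolded q_def r_def] \<beta>1(1)]
  show False using \<beta>1(2) by simp
qed

end
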